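(* Let $a,b,c,d,e,f,g,h$ be nonzero complex numbers with $bcdefgh=a^3q^2$. Fix any one of the seven positions $b,c,d,e,f,g,h$ as the distinguished one and let $\Phi(a;b,c,d,e,f,g,h)$ denote the corresponding function $\Phi^{(p)}(a;b,c,d,e,f,g,h;q)$ (the distinguished position stays the same in all terms below). Put $\Phi=\Phi(a;b,c,d,e,f,g,h)$, $\Phi_+(g-)=\Phi(aq^2;bq,cq,dq,eq,fq,g,hq)$ and $\Phi_-(g+)=\Phi(a/q^2;b/q,c/q,d/q,e/q,f/q,g,h/q)$. Then, with all products over $p\in\{b,c,d,e,f\}$, $$\frac{agq}{h}\,\frac{(1-aq)(1-aq^2)\prod_p(1-\frac{aq}{gp})}{(1-\frac{aq}{g})(1-\frac{aq^2}{g})\prod_p(1-\frac{aq}{p})}\Bigl(1-\frac{gh}{aq}\Bigr)(1-h)\prod_p(1-p)\;\Phi_+(g-)$$ $$-\frac{q(1-\frac ag)(1-\frac{aq}{g})(1-\frac ah)(1-\frac{aq}{h})\prod_p(1-\frac ap)}{(1-\frac aq)(1-a)}\;\Phi_-(g+)$$ $$-\Biggl[\frac{aq}{h}\Bigl(1-\frac hg\Bigr)\Bigl(1-\frac{gh}{aq}\Bigr)\prod_p(1-p)+\frac{g^2q^2}{h}\,\frac{(1-\frac{aq}{g})(1-\frac ah)(1-\frac{aq}{h})(1-\frac hq)\prod_p(1-\frac{a}{gp})}{(1-\frac{gq}{h})(1-\frac{a}{gq})}$$ $$-\frac{h(1-g)(1-\frac ag)(1-\frac{aq}{g})\prod_p(1-\frac{aq}{hp})}{1-\frac{gq}{h}}\Biggr]\Phi=0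 .$$
   Context: Throughout $q\in\mathbb C$, $0<|q|<1$; $(x)_0=1$, $(x)_k=\prod_{j=0}^{k-1}(1-xq^j)$, $(x)_\infty=\prod_{j\ge 0}(1-xq^j)$, and $(x_1,\dots,x_r)_k=\prod_i (x_i)_k$ for $k\in\mathbb{Z}_{\ge0}\cup\{\infty\}$. Products over $p\in\{b,c,\dots\}$ are over the listed letters, with multiplicity. The balanced very-well-poised series is $${}_{10}W_9(a;p_1,\dots,p_7;q)=\sum_{k=0}^\infty \frac{1-aq^{2k}}{1-a}\,\frac{(a,p_1,\dots,p_7)_k}{(q,aq/p_1,\dots,aq/p_7)_k}\,q^k,\qquad p_1p_2\cdots p_7=a^3q^2 .$$ For a distinguished position $i$, with $p=p_i$, $$\Phi^{(p)}(a;p_1,\dots,p_7;q)={}_{10}W_9(a;p_1,\dots,p_7;q)+\frac{(aq,\,p_i/a)_\infty}{(p_i^2q/a,\,a/p_i)_\infty}\prod_{j\ne i}\frac{(p_j,\;p_iq/p_j)_\infty}{(aq/p_j,\;p_ip_j/a)_\infty}\;{}_{10}W_9\Bigl(\tfrac{p_i^2}{a};\,p_i,\bigl(\tfrac{p_ip_j}{a}\bigr)_{j\ne i};q\Bigr).$$ Standing assumption: parameters are such that no zero denominators (singularities) occur; in particular $a$ is different from the distinguished parameter. *)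

theory Defs
  imports "HOL-Analysis.Analysis"
begin

definition qpoch :: "complex \<Rightarrow> complex \<Rightarrow> nat \<Rightarrow> complex" where
  "qpoch q x k = (\<Prod>j<k. 1 - x * q ^ j)"

definition qpoch_inf :: "complex \<Rightarrow> complex \<Rightarrow> complex" where
  "qpoch_inf q x = (\<Prod>j. 1 - x * q ^ j)"

definition qpochs :: "complex \<Rightarrow> complex list \<Rightarrow> nat \<Rightarrow> complex" where
  "qpochs q xs k = (\<Prod>x\<leftarrow>xs. qpoch q x k)"

text \<open>The list \<open>ps\<close> holds the parameters \<open>p\<^sub>1, \<dots>, p\<^sub>7\<close>. The balancing condition
  \<open>p\<^sub>1 \<cdots> p\<^sub>7 = a\<^sup>3 q\<^sup>2\<close> is not built in and has to be assumed where needed.\<close>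

definition W10_9 :: "complex \<Rightarrow> complex \<Rightarrow> complex list \<Rightarrow> complex" where
  "W10_9 q a ps =
     (\<Sum>k. (1 - a * q ^ (2 * k)) / (1 - a)
           * (qpochs q (a # ps) k / qpochs q (q # map (\<lambda>p. a * q / p) ps) k) * q ^ k)"

definition others :: "'a list \<Rightarrow> nat \<Rightarrow> 'a list" where
  "others ps i = take i ps @ drop (Suc i) ps"

text \<open>Positions are counted from 0; the distinguished parameter is \<open>ps ! i\<close>.\<close>

definition Phi :: "complex \<Rightarrow> nat \<Rightarrow> complex \<Rightarrow> complex list \<Rightarrow> complex" where
  "Phi q i a ps =
     (let p = ps ! i in
       W10_9 q a ps
       + (qpoch_inf q (a * q) * qpoch_inf q (p / a)) / (qpoch_inf q (p\<^sup>2 * q / a) * qpoch_inf q (a / p))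
         * (\<Prod>r\<leftarrow>others ps i. (qpoch_inf q r * qpoch_inf q (p * q / r))
                               / (qpoch_inf q (a * q / r) * qpoch_inf q (p * r / a)))
         * W10_9 q (p\<^sup>2 / a) (p # map (\<lambda>r. p * r / a) (others ps i)))"

text \<open>The standing assumption that no denominator vanishes. In \<open>Phi_nonsingular\<close> the condition on
  \<open>(a/p)\<^sub>\<infinity>\<close> contains \<open>a \<noteq> p\<close>.\<close>

definition W10_9_nonsingular :: "complex \<Rightarrow> complex \<Rightarrow> complex list \<Rightarrow> bool" where
  "W10_9_nonsingular q a ps \<longleftrightarrow>
     a \<noteq> 1 \<and> (\<forall>k. qpochs q (q # map (\<lambda>p. a * q / p) ps) k \<noteq> 0)"

definition Phi_nonsingular :: "complex \<Rightarrow> nat \<Rightarrow> complex \<Rightarrow> complex list \<Rightarrow> bool" where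
  "Phi_nonsingular q i a ps \<longleftrightarrow>
     (let p = ps ! i in
       W10_9_nonsingular q a ps
       \<and> qpoch_inf q (p\<^sup>2 * q / a) \<noteq> 0 \<and> qpoch_inf q (a / p) \<noteq> 0
       \<and> (\<forall>r\<in>set (others ps i). qpoch_inf q (a * q / r) \<noteq> 0 \<and> qpoch_inf q (p * r / a) \<noteq> 0)
       \<and> W10_9_nonsingular q (p\<^sup>2 / a) (p # map (\<lambda>r. p * r / a) (others ps i)))"

end

(* Write t_k for the summand of the series W(a; g, S), S the list of the six letters other than g.
   The summands of the shifted series, with indices k - 1 and k + 1, are rational multiples of t_k
   in z = q^k, and a polynomial identity in z (coef_identity) makes a combination of the three
   telescope.  The sum therefore equals the limit of the telescoping sequence, an infinite product.
   At z = (p/a) q^k the same identity makes the second series in Phi telescope, and the weight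
   in front of that series is such that the two infinite products cancel.  *)

theory Submission
  imports Defs
begin

section \<open>q-shifted factorials and summability\<close>

text \<open>Three coefficients suffice because of a symmetry. By the balancing condition the
  involution z -> 1/(a z) exchanges, up to the factor a^4 z^8, the two products of degree 8 whose
  difference is telescoped. That difference vanishes at z = 0 and where a z^2 = 1, and division by z
  (1 - a z^2) leaves a quartic that is self-reciprocal under the involution. Such quartics form a
  three-dimensional space, and each of the three series contributes one of them. The constant 1 -
  g/q in front of the difference keeps the coefficients free of a pole at g = q.

  The distinguished letter forces two cases. If it is a shifted letter p, the base p^2/a of the
  companion series and its letters p r/a, r another shifted letter, do not move, while p and p g/a
  move in opposite directions. If it is g, the base g^2/a and its letters move against a, so the
  upward and the downward shift trade places. Hence two kinds of telescoping relations, driven by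
  one set of coefficients.\<close>

definition pprod :: "complex list \<Rightarrow> complex \<Rightarrow> complex" where
  "pprod S x = (\<Prod>p\<leftarrow>S. 1 - p * x)"

definition rprod :: "complex list \<Rightarrow> complex \<Rightarrow> complex" where
  "rprod S x = (\<Prod>p\<leftarrow>S. 1 - x / p)"

definition qpochs_inf :: "complex \<Rightarrow> complex list \<Rightarrow> complex" where
  "qpochs_inf q xs = (\<Prod>x\<leftarrow>xs. qpoch_inf q x)"

lemma pprod_simps [simp]: "pprod [] x = 1" "pprod (p # S) x = (1 - p * x) * pprod S x"
  by (simp_all add: pprod_def)

lemma rprod_simps [simp]: "rprod [] x = 1" "rprod (p # S) x = (1 - x / p) * rprod S x"
  by (simp_all add: rprod_def)

lemma qpochs_inf_simps [simp]:
  "qpochs_inf q [] = 1" "qpochs_inf q (p # S) = qpoch_inf q p * qpochs_inf q S"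
  by (simp_all add: qpochs_inf_def)

lemma qpochs_simps [simp]: "qpochs q [] k = 1" "qpochs q (x # xs) k = qpoch q x k * qpochs q xs k"
  by (simp_all add: qpochs_def)

lemma qpoch_0 [simp]: "qpoch q x 0 = 1"
  by (simp add: qpoch_def)

lemma qpoch_Suc: "qpoch q x (Suc k) = qpoch q x k * (1 - x * q ^ k)"
  by (simp add: qpoch_def)

lemma qpoch_Suc': "qpoch q x (Suc k) = (1 - x) * qpoch q (x * q) k"
  by (simp add: qpoch_def prod.lessThan_Suc_shift mult.assoc del: prod.lessThan_Suc)

lemma qpochs_0 [simp]: "qpochs q xs 0 = 1"
  by (induction xs) auto

lemma qpochs_Suc: "qpochs q xs (Suc k) = qpochs q xs k * pprod xs (q ^ k)"
  by (induction xs) (auto simp: qpoch_Suc)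

lemma qpochs_Suc': "qpochs q xs (Suc k) = pprod xs 1 * qpochs q (map (\<lambda>x. x * q) xs) k"
  by (induction xs) (auto simp: qpoch_Suc')

lemma pprod_map_div: "pprod (map (\<lambda>p. x / p) S) y = rprod S (x * y)"
  by (induction S) auto

lemma pprod_map_divide: "pprod (map (\<lambda>p. p / x) S) y = pprod S (y / x)"
  by (induction S) auto

section \<open>Convergence of the infinite products and of the series\<close>

lemma convergent_prod_qpoch:
  fixes q x :: complex
  assumes "norm q < 1"
  shows "convergent_prod (\<lambda>j. 1 - x * q ^ j)"
proof -
  have "summable (\<lambda>j. norm x * norm q ^ j)"
    using assms by (intro summable_mult summable_geometric) auto
  then have "abs_convergent_prod (\<lambda>j. 1 - x * q ^ j)"
    unfolding abs_convergent_prod_conv_summable by (simp add: norm_mult norm_power)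
  then show ?thesis
    by (rule abs_convergent_prod_imp_convergent_prod)
qed

lemma qpoch_tendsto:
  assumes "norm q < 1"
  shows "qpoch q x \<longlonglongrightarrow> qpoch_inf q x"
proof -
  have "(\<lambda>n. \<Prod>j\<le>n. 1 - x * q ^ j) \<longlonglongrightarrow> qpoch_inf q x"
    unfolding qpoch_inf_def by (rule convergent_prod_LIMSEQ[OF convergent_prod_qpoch[OF assms]])
  then have "(\<lambda>n. qpoch q x (Suc n)) \<longlonglongrightarrow> qpoch_inf q x"
    by (simp add: qpoch_def lessThan_Suc_atMost)
  then show ?thesis
    by (rule LIMSEQ_imp_Suc)
qed

lemma qpoch_inf_unfold:
  assumes "norm q < 1"
  shows "qpoch_inf q x = (1 - x) * qpoch_inf q (x * q)"
proof (rule LIMSEQ_unique)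
  show "(\<lambda>k. qpoch q x (Suc k)) \<longlonglongrightarrow> qpoch_inf q x"
    by (rule LIMSEQ_Suc[OF qpoch_tendsto[OF assms]])
  show "(\<lambda>k. qpoch q x (Suc k)) \<longlonglongrightarrow> (1 - x) * qpoch_inf q (x * q)"
    unfolding qpoch_Suc' by (intro tendsto_intros qpoch_tendsto[OF assms])
qed

text \<open>A convergent infinite product vanishes only if one of its factors does, and such a
  factor would already annihilate a finite product.\<close>

lemma qpoch_inf_nonzero:
  assumes "norm q < 1" and "\<And>k. qpoch q x k \<noteq> 0"
  shows "qpoch_inf q x \<noteq> 0"
  unfolding qpoch_inf_def
proof (rule prodinf_nonzero[OF convergent_prod_qpoch[OF assms(1)]])
  fix j show "1 - x * q ^ j \<noteq> 0"
    using assms(2)[of "Suc j"] by (simp add: qpoch_Suc)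
qed

lemma qpochs_tendsto:
  assumes "norm q < 1"
  shows "qpochs q xs \<longlonglongrightarrow> qpochs_inf q xs"
proof (induction xs)
  case (Cons x xs)
  then have "(\<lambda>k. qpoch q x k * qpochs q xs k) \<longlonglongrightarrow> qpoch_inf q x * qpochs_inf q xs"
    by (intro tendsto_intros qpoch_tendsto[OF assms])
  then show ?case
    by (simp add: qpochs_def qpochs_inf_def)
qed (auto simp: qpochs_def)

lemma qpochs_inf_nonzero:
  assumes "norm q < 1" and "\<And>k. qpochs q xs k \<noteq> 0"
  shows "qpochs_inf q xs \<noteq> 0"
  using assms(2) by (induction xs) (auto simp: qpoch_inf_nonzero[OF assms(1)])

lemma summable_bounded_geometric:
  fixes q :: complex
  assumes "norm q < 1" and "convergent X"
  shows "summable (\<lambda>k. X k * q ^ k)"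
proof -
  obtain M where M: "\<And>k. norm (X k) \<le> M"
    using convergent_imp_Bseq[OF assms(2)] by (auto simp: Bseq_def)
  show ?thesis
  proof (rule summable_comparison_test)
    show "\<exists>N. \<forall>n\<ge>N. norm (X n * q ^ n) \<le> M * norm q ^ n"
      using M by (auto simp: norm_mult norm_power intro!: mult_right_mono)
    show "summable (\<lambda>n. M * norm q ^ n)"
      using assms(1) by (intro summable_mult summable_geometric) auto
  qed
qed

definition wterm :: "complex \<Rightarrow> complex \<Rightarrow> complex list \<Rightarrow> nat \<Rightarrow> complex" where
  "wterm q a ps k = (1 - a * q ^ (2 * k)) / (1 - a)
           * (qpochs q (a # ps) k / qpochs q (q # map (\<lambda>p. a * q / p) ps) k) * q ^ k"

text \<open>Makes the \<open>suminf\<close> in \<open>W10_9\<close> a genuine sum. The cofactor of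
  \<open>q ^ k\<close> converges, since its denominators have non-zero limits by nonsingularity, and
  a bounded multiple of a geometric series is summable.\<close>

lemma W10_9_sums:
  assumes "norm q < 1" and "W10_9_nonsingular q a ps"
  shows "wterm q a ps sums W10_9 q a ps"
proof -
  have "(\<lambda>k. q ^ (2 * k)) \<longlonglongrightarrow> 0"
    using assms(1) by (simp add: power_mult LIMSEQ_power_zero norm_power power_less_one_iff)
  then have "(\<lambda>k. (1 - a * q ^ (2 * k)) / (1 - a)
        * (qpochs q (a # ps) k / qpochs q (q # map (\<lambda>p. a * q / p) ps) k))
      \<longlonglongrightarrow> (1 - a * 0) / (1 - a)
        * (qpochs_inf q (a # ps) / qpochs_inf q (q # map (\<lambda>p. a * q / p) ps))"
    using assms by (intro tendsto_intros qpochs_tendsto qpochs_inf_nonzero)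
       (auto simp: W10_9_nonsingular_def)
  then have "summable (wterm q a ps)"
    unfolding wterm_def by (intro summable_bounded_geometric[OF assms(1)] convergentI)
  then show ?thesis
    unfolding W10_9_def wterm_def by (rule summable_sums)
qed

lemma W10_9_nonsingularD:
  assumes "W10_9_nonsingular q a ps"
  shows "a \<noteq> 1" "qpoch q q k \<noteq> 0" "qpochs q (map (\<lambda>p. a * q / p) ps) k \<noteq> 0"
  using assms by (auto simp: W10_9_nonsingular_def)

section \<open>Telescoping of three contiguous series\<close>

text \<open>V collects the q-shifted factorials that the summands share. Dividing them out leaves
  the polynomial identity of the first hypothesis; both telescoping relations end in this
  way.\<close>

lemma telescoping_step:
  fixes V :: complex
  assumes "V \<noteq> 0 \<Longrightarrow> l * (X - Y) = w * z * (A' + B' + C')"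
    and "z \<noteq> 0" and "sp = V * w * A'" and "sm = V * w * B'" and "s0 = V * w * C'"
    and "F = l * V / z * X" and "E = l * V / z * Y"
  shows "sp + sm + s0 = F - E"
proof (cases "V = 0")
  case False
  have "F - E = V / z * (l * (X - Y))"
    unfolding assms by (simp add: algebra_simps)
  also have "\<dots> = V * w * (A' + B' + C')"
    using assms(1)[OF False] assms(2) by simp
  finally show ?thesis
    unfolding assms by (simp add: algebra_simps)
qed (use assms in auto)

section \<open>Fixed base, two letters shifted in opposite directions\<close>

lemma transfer_shifted_term:
  fixes K :: complex
  assumes "p1 * Pq = Pm * u1 * u2" "Gq = g1 * Gm" "QG = G1 * YG" "p0 * Qp = Yp * v1 * v2"
    "p0 \<noteq> 0" "Qp \<noteq> 0" "Yp \<noteq> 0"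
  shows "K * p1 * p0 / G1 * (w / a1 * (Xa * (Pq * (Gq * Xr)) / (Yq * (Yp * (YG * Yr)))) * z)
    = (Xa * Xr * Pm * Gm * z / (Yq * Yr * Qp * QG * a1)) * w * (K * g1 * u1 * u2 * v1 * v2)"
proof -
  \<comment> \<open>The atoms stand for q-shifted factorials and their boundary factors, so that no
    product is multiplied out. The only quotient to be rewritten belongs to the denominator symbol
    whose argument moved down; the rest is substitution.\<close>
  have "p0 / Yp = v1 * v2 / Qp"
    using assms(4-7) by (simp add: field_simps)
  then have "K * (p1 * Pq) * (p0 / Yp) * w * Xa * Gq * Xr * z / (a1 * Yq * YG * Yr * G1)
    = K * (Pm * u1 * u2) * (v1 * v2 / Qp) * w * Xa * (g1 * Gm) * Xr * z / (a1 * Yq * YG * Yr * G1)"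
    by (simp only: assms)
  then show ?thesis
    unfolding assms(3) by (simp add: mult_ac)
qed

lemma transfer_start_term:
  fixes A :: complex
  assumes "l * P * g = A * p1 * p0 * pq + B * G1 * G0 * g * Gq + C * g * Gq * pq"
    and "g \<noteq> 0" "pq \<noteq> 0" "Gq \<noteq> 0"
  shows "A * p1 * p0 / (g * Gq) + B * G1 * G0 / pq + C = l * P / (pq * Gq)"
proof -
  have lP: "l * P = (A * p1 * p0 * pq + B * G1 * G0 * g * Gq + C * g * Gq * pq) / g"
    using assms by (simp add: eq_divide_eq)
  show ?thesis
    unfolding lP using assms(2-) by (simp add: field_simps)
qed

lemma transfer_level_term:
  fixes K :: complex
  assumes "v1 \<noteq> 0" "v2 \<noteq> 0"
  shows "K * (w / a1 * (Xa * (Pm * u1 * (Gm * u2 * Xr)) / (Yq * (Q1 * (Q2 * Yr)))) * z)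
    = (Xa * Xr * Pm * Gm * z / (Yq * Yr * (Q1 * v1) * (Q2 * v2) * a1)) * w * (K * u1 * v1 * u2 * v2)"
  using assms by (simp add: mult_ac)

lemma transfer_boundary_term:
  fixes l :: complex
  assumes "v0 \<noteq> 0" "v1 \<noteq> 0" "v2 \<noteq> 0" "v3 \<noteq> 0" "z \<noteq> 0"
  shows "l / a1 * (Xa * Pm * Gm * Xr) / (Yq * Q1 * Q2 * Yr)
    = l * (Xa * Xr * Pm * Gm * z / ((Yq * v0) * (Yr * v1) * (Q1 * v2) * (Q2 * v3) * a1)) / z * (v0 * v1 * v2 * v3)"
  using assms by (simp add: mult_ac)

text \<open>With z = q^k, \<open>step\<close> gives the telescoping for the summands of index k
  \<ge> 1. At z = 1 it reads as \<open>start\<close> multiplied by (1 - a)(1 - p/q), the second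
  boundary product being zero there. Since this factor vanishes for p = q, \<open>start\<close> is a
  hypothesis of its own.\<close>

lemma W10_9_transfer_relation:
  fixes q a p G l A B1 C :: complex and R :: "complex list"
  assumes q: "q \<noteq> 0" "norm q < 1"
    and nz: "a \<noteq> 0" "p \<noteq> 0" "G \<noteq> 0" "\<forall>r\<in>set R. r \<noteq> 0" "G \<noteq> q"
    and ns: "W10_9_nonsingular q a (p # G # R)"
      "W10_9_nonsingular q a (p * q # G / q # R)"
      "W10_9_nonsingular q a (p / q # G * q # R)"
    and start: "l * pprod R 1 * (1 - G / q) = A * (1 - p) * (1 - a / p) * (1 - a * q / p)
      + B1 * (1 - G) * (1 - a / G) * (1 - G / q) * (1 - a * q / G)
      + C * (1 - G / q) * (1 - a * q / G) * (1 - a * q / p)"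
    and step: "\<And>z. z \<noteq> 0 \<Longrightarrow>
      l * ((1 - a * z) * pprod R z * (1 - p * z / q) * (1 - G * z / q)
           - (1 - z) * rprod R (a * z) * (1 - a * q * z / p) * (1 - a * q * z / G))
      = (1 - a * z\<^sup>2) * z *
        (A * (1 - p * z) * (1 - a * z / p) * (1 - p * z / q) * (1 - a * q * z / p)
         + B1 * (1 - p / q) * (1 - G * z) * (1 - a * z / G) * (1 - G * z / q) * (1 - a * q * z / G)
         + C * (1 - p * z / q) * (1 - a * q * z / p) * (1 - G * z / q) * (1 - a * q * z / G))"
  shows "A * (1 - p) * (1 - a / p) / ((1 - G / q) * (1 - a * q / G))
           * W10_9 q a (p * q # G / q # R)
         + B1 * (1 - G) * (1 - a / G) / (1 - a * q / p) * W10_9 q a (p / q # G * q # R)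
         + C * W10_9 q a (p # G # R)
       = l / (1 - a) * (qpoch_inf q a * qpoch_inf q p * qpoch_inf q G * qpochs_inf q R)
         / (qpoch_inf q q * qpoch_inf q (a * q / p) * qpoch_inf q (a * q / G)
            * qpochs_inf q (map (\<lambda>r. a * q / r) R))"
proof -
  let ?R = "map (\<lambda>r. a * q / r) R"
  define cp where "cp = A * (1 - p) * (1 - a / p) / ((1 - G / q) * (1 - a * q / G))"
  define cm where "cm = B1 * (1 - G) * (1 - a / G) / (1 - a * q / p)"
  define t where "t k = cp * wterm q a (p * q # G / q # R) k
      + cm * wterm q a (p / q # G * q # R) k + C * wterm q a (p # G # R) k" for k
  \<comment> \<open>The index offsets make \<open>F (Suc m)\<close> and \<open>F m\<close> equal to
    l V/z times the first and the second product on the left of \<open>step\<close> at z = q^(m+1),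
    with V the common factor of the summands introduced below.\<close>
  define F where "F k = l / (1 - a) *
      (qpoch q a (Suc k) * qpoch q p k * qpoch q G k * qpochs q R (Suc k))
      / (qpoch q q k * qpoch q (a * q / p) (Suc k) * qpoch q (a * q / G) (Suc k)
            * qpochs q ?R k)" for k
  have a1: "1 - a \<noteq> 0"
    using W10_9_nonsingularD(1)[OF ns(1)] by simp
  have Gq: "1 - G / q \<noteq> 0"
    using nz q by (simp add: field_simps)
  have nq: "qpoch q q k \<noteq> 0" and nR: "qpochs q ?R k \<noteq> 0"
    and np: "qpoch q (a * q / p) k \<noteq> 0" and nG: "qpoch q (a * q / G) k \<noteq> 0"
    and np': "qpoch q (a / p) k \<noteq> 0" and nG': "qpoch q (a / G) k \<noteq> 0" for k
    using W10_9_nonsingularD(2,3)[OF ns(1), of k] W10_9_nonsingularD(3)[OF ns(2), of k]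
      W10_9_nonsingularD(3)[OF ns(3), of k] q by simp_all
  have p1: "1 - a * q / p \<noteq> 0" and G1: "1 - a * q / G \<noteq> 0"
    using np[of 1] nG[of 1] by (simp_all add: qpoch_def)
  have p0: "1 - a / p \<noteq> 0" and G0: "1 - a / G \<noteq> 0"
    using np'[of 1] nG'[of 1] by (simp_all add: qpoch_def)
  have t_0: "t 0 = F 0"
  proof -
    have "cp + cm + C = l * pprod R 1 / ((1 - a * q / p) * (1 - a * q / G))"
      unfolding cp_def cm_def by (rule transfer_start_term[OF start Gq p1 G1])
    then show ?thesis
      using a1 by (simp add: t_def F_def wterm_def qpoch_Suc qpochs_Suc)
  qed
  have t_Suc: "t (Suc m) = F (Suc m) - F m" for m
  proof -
    define z where "z = q ^ Suc m"
    have z: "z \<noteq> 0" using q by (simp add: z_def)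
    have zm: "x * q ^ m = x * z / q" for x using q by (simp add: z_def)
    \<comment> \<open>The common factor of the three summands of index m + 1. The symbols of p and G
      stop one factor early in the numerator, those of a q/p and a q/G run one factor further in the
      denominator; each summand is then a constant multiple of V times a polynomial in z.\<close>
    define V where "V = qpoch q a (Suc m) * qpochs q R (Suc m) * qpoch q p m * qpoch q G m * z
       / (qpoch q q (Suc m) * qpochs q ?R (Suc m) * qpoch q (a * q / p) (Suc (Suc m))
          * qpoch q (a * q / G) (Suc (Suc m)) * (1 - a))"
    have p_Suc: "qpoch q p (Suc m) = qpoch q p m * (1 - p * z / q)"
      and G_Suc: "qpoch q G (Suc m) = qpoch q G m * (1 - G * z / q)"
      and ap_Suc: "qpoch q (a * q / p) (Suc (Suc m)) = qpoch q (a * q / p) (Suc m) * (1 - a * q * z / p)"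
      and aG_Suc: "qpoch q (a * q / G) (Suc (Suc m)) = qpoch q (a * q / G) (Suc m) * (1 - a * q * z / G)"
      and a_Suc: "qpoch q a (Suc (Suc m)) = qpoch q a (Suc m) * (1 - a * z)"
      and q_Suc: "qpoch q q (Suc m) = qpoch q q m * (1 - z)"
      and R_Suc: "qpochs q R (Suc (Suc m)) = qpochs q R (Suc m) * pprod R z"
      and aR_Suc: "qpochs q ?R (Suc m) = qpochs q ?R m * rprod R (a * z)"
      by (simp_all add: qpoch_Suc qpochs_Suc zm z_def pprod_map_div del: power_Suc)
    have shift_up: "(1 - x) * qpoch q (x * q) (Suc m) = qpoch q x m * (1 - x * z / q) * (1 - x * z)" for x
      unfolding qpoch_Suc'[symmetric] using q by (simp add: z_def qpoch_Suc mult_ac)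
    have shift_down: "qpoch q (x / q) (Suc m) = (1 - x / q) * qpoch q x m" for x
      using q by (simp add: qpoch_Suc')
    have den_up: "qpoch q (x * q) (Suc (Suc m)) = (1 - x * q) * qpoch q (x * q * q) (Suc m)" for x
      by (rule qpoch_Suc')
    have den_down: "(1 - x) * qpoch q (x * q) (Suc (Suc m)) = qpoch q x (Suc m) * (1 - x * z) * (1 - x * q * z)" for x
      unfolding qpoch_Suc'[symmetric] by (simp add: z_def qpoch_Suc mult_ac)
    define w where "w = 1 - a * z\<^sup>2"
    have w: "1 - a * q ^ (2 * Suc m) = w"
      unfolding w_def z_def by (simp only: power_mult mult.commute[of 2])
    have sp: "cp * wterm q a (p * q # G / q # R) (Suc m) = V * w
        * (A * (1 - p * z) * (1 - a * z / p) * (1 - p * z / q) * (1 - a * q * z / p))"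
    proof -
      have "A / (1 - G / q) * (1 - p) * (1 - a / p) / (1 - a * q / G)
          * (w / (1 - a) * (qpoch q a (Suc m) * (qpoch q (p * q) (Suc m) * (qpoch q (G / q) (Suc m) * qpochs q R (Suc m)))
              / (qpoch q q (Suc m) * (qpoch q (a / p) (Suc m) * (qpoch q (a * q / G * q) (Suc m) * qpochs q ?R (Suc m))))) * z)
        = V * w * (A / (1 - G / q) * (1 - G / q) * (1 - p * z / q) * (1 - p * z) * (1 - a / p * z) * (1 - a / p * q * z))"
        unfolding V_def
        by (rule transfer_shifted_term) (use shift_up[of p] shift_down[of G] den_up[of "a / G"] den_down[of "a / p"]
           np'[of "Suc m"] np[of "Suc (Suc m)"] p0 in simp_all)
      then show ?thesis
        using Gq q unfolding wterm_def cp_def w by (simp add: z_def mult_ac)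
    qed
    have sm: "cm * wterm q a (p / q # G * q # R) (Suc m) = V * w
        * (B1 * (1 - p / q) * (1 - G * z) * (1 - a * z / G) * (1 - G * z / q) * (1 - a * q * z / G))"
    proof -
      have "B1 * (1 - G) * (1 - a / G) / (1 - a * q / p)
          * (w / (1 - a) * (qpoch q a (Suc m) * (qpoch q (G * q) (Suc m) * (qpoch q (p / q) (Suc m) * qpochs q R (Suc m)))
              / (qpoch q q (Suc m) * (qpoch q (a / G) (Suc m) * (qpoch q (a * q / p * q) (Suc m) * qpochs q ?R (Suc m))))) * z)
        = (qpoch q a (Suc m) * qpochs q R (Suc m) * qpoch q G m * qpoch q p m * z
       / (qpoch q q (Suc m) * qpochs q ?R (Suc m) * qpoch q (a * q / G) (Suc (Suc m))
          * qpoch q (a * q / p) (Suc (Suc m)) * (1 - a))) * w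
           * (B1 * (1 - p / q) * (1 - G * z / q) * (1 - G * z) * (1 - a / G * z) * (1 - a / G * q * z))"
        by (rule transfer_shifted_term) (use shift_up[of G] shift_down[of p] den_up[of "a / p"] den_down[of "a / G"]
           nG'[of "Suc m"] nG[of "Suc (Suc m)"] G0 in simp_all)
      then show ?thesis
        using q unfolding wterm_def cm_def w V_def by (simp add: z_def mult_ac)
    qed
    have nonzero_last: "1 - a * q * z / p \<noteq> 0" "1 - a * q * z / G \<noteq> 0"
      using np[of "Suc (Suc m)"] nG[of "Suc (Suc m)"] unfolding ap_Suc aG_Suc by auto
    have s0: "C * wterm q a (p # G # R) (Suc m) = V * w
        * (C * (1 - p * z / q) * (1 - a * q * z / p) * (1 - G * z / q) * (1 - a * q * z / G))"
      unfolding wterm_def V_def w list.map qpochs_simps p_Suc G_Suc ap_Suc aG_Suc z_def[symmetric]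
      by (rule transfer_level_term[OF nonzero_last])
    have "1 - z \<noteq> 0" "rprod R (a * z) \<noteq> 0"
      using nq[of "Suc m"] nR[of "Suc m"] unfolding q_Suc aR_Suc by auto
    then have F0: "F m = l * V / z * ((1 - z) * rprod R (a * z) * (1 - a * q * z / p) * (1 - a * q * z / G))"
      unfolding F_def V_def ap_Suc aG_Suc aR_Suc q_Suc
      by (rule transfer_boundary_term[OF _ _ nonzero_last z])
    have F1: "F (Suc m) = l * V / z * ((1 - a * z) * pprod R z * (1 - p * z / q) * (1 - G * z / q))"
      using z unfolding F_def V_def a_Suc p_Suc G_Suc R_Suc by (simp add: mult_ac)
    show ?thesis
      unfolding t_def
      by (rule telescoping_step[OF _ z sp sm s0 F1 F0]) (use step[OF z] in \<open>simp add: w_def\<close>)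
  qed
  have F_lim: "F \<longlonglongrightarrow> l / (1 - a) * (qpoch_inf q a * qpoch_inf q p * qpoch_inf q G * qpochs_inf q R)
         / (qpoch_inf q q * qpoch_inf q (a * q / p) * qpoch_inf q (a * q / G) * qpochs_inf q ?R)"
    (is "_ \<longlonglongrightarrow> ?L")
    unfolding F_def using nq nR np nG
    by (intro tendsto_intros LIMSEQ_Suc qpoch_tendsto qpochs_tendsto q)
       (auto simp: qpoch_inf_nonzero[OF q(2)] qpochs_inf_nonzero[OF q(2)])
  have "(\<lambda>m. t (Suc m)) sums (?L - F 0)"
    unfolding t_Suc by (rule telescope_sums[OF F_lim])
  then have "t sums ?L"
    unfolding sums_Suc_iff t_0 by simp
  moreover have "t sums (cp * W10_9 q a (p * q # G / q # R)
         + cm * W10_9 q a (p / q # G * q # R) + C * W10_9 q a (p # G # R))"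
    unfolding t_def by (intro sums_add sums_mult W10_9_sums q ns)
  ultimately show ?thesis
    unfolding cp_def cm_def by (rule sums_unique2[symmetric])
qed

section \<open>Base shifted by q^2, six letters shifted by q, one letter fixed\<close>

lemma shift_up_term:
  fixes A :: complex
  assumes "n1 * n2 * P2 = Pa * u1 * u2" "s1 * Sq = S1" "Q2 = Q0 * v1 * v2" "QG = G1 * G2 * YG"
    "RS = R1 * YR" "z = q * z0" "n1 \<noteq> 0" "d \<noteq> 0" "v1 \<noteq> 0" "v2 \<noteq> 0"
  shows "A * (q * n2 * d * s1 / (G1 * G2 * R1)) * (w / d * (P2 * (Gm * Sq) / (Q0 * (YG * YR))) * z0)
    = (Pa * Gm * S1 * z / (Q2 * RS * QG * n1)) * w * (A * u2 * v1 * u1 * v2)"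
proof -
  have "n2 * P2 = Pa * u1 * u2 / n1"
    using assms(1,7) by (simp add: field_simps)
  then have "A * q * (n2 * P2) * (s1 * Sq) * w * Gm * z0 / (G1 * G2 * R1 * Q0 * YG * YR)
     = A * q * (Pa * u1 * u2 / n1) * S1 * w * Gm * z0 / (G1 * G2 * R1 * Q0 * YG * YR)"
    by (simp only: assms)
  then show ?thesis
    unfolding assms(3-6) using assms(7-10) by (simp add: mult_ac)
qed

lemma shift_down_term:
  fixes w :: complex
  assumes "d \<noteq> 0" "n \<noteq> 0" "x1 \<noteq> 0" "x2 \<noteq> 0" "Ra \<noteq> 0"
  shows "Ra / (n1 * n) * (w / d * (d * n * Pa * (Gm * w1 * w2 * (Pq * S1))
      / (Q2 * (h1 * h2 * YG * (Ra * RS)))) * (z * q))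
    = (Pa * Gm * S1 * z / (Q2 * RS * (YG * x1 * x2) * n1)) * w
      * (q * Pq / (h1 * h2) * w2 * x1 * w1 * x2)"
  using assms by (simp add: mult_ac)

lemma shift_level_term:
  fixes w :: complex
  assumes "v \<noteq> 0" "x \<noteq> 0"
  shows "C * (w / n1 * (Pa * u * (Gm * w1 * S1) / (Q1 * (YG * RS))) * z)
    = (Pa * Gm * S1 * z / (Q1 * v * RS * (YG * x) * n1)) * w * (C * w1 * x * u * v)"
  using assms by (simp add: mult_ac)

lemma shift_start_term:
  fixes P1 :: complex
  assumes "P1 * n * l - Ra * Q * G1 = n1 * G1 * (q * Pq / (h1 * h2) * g * h2 + C * n * Q)"
    "n \<noteq> 0" "Q \<noteq> 0" "G1 \<noteq> 0" "n1 \<noteq> 0" "h1 \<noteq> 0" "h2 \<noteq> 0" "Ra \<noteq> 0" "d \<noteq> 0"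
  shows "Ra / (n1 * n) * (1 + n1 / d * (d * (g * Pq) / (Q * (h1 * Ra))) * q) + C = l / n1 * P1 / (Q * G1)"
proof -
  have lP: "l * P1 = (Ra * Q * G1 + n1 * G1 * (q * Pq / (h1 * h2) * g * h2 + C * n * Q)) / n"
    using assms by (simp add: eq_divide_eq diff_eq_eq mult_ac)
  have "l / n1 * P1 / (Q * G1) = (l * P1) / (n1 * Q * G1)"
    by simp
  also have "\<dots> = Ra / (n1 * n) * (1 + n1 / d * (d * (g * Pq) / (Q * (h1 * Ra))) * q) + C"
    unfolding lP using assms(2-) by (simp add: field_simps)
  finally show ?thesis ..
qed

lemma shift_boundary_term:
  fixes l :: complex
  assumes "v1 \<noteq> 0" "v2 \<noteq> 0" "v3 \<noteq> 0" "z \<noteq> 0"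
  shows "l / a1 * (Xa * Gm * Xr) / (Yq * Q1 * Yr)
    = l * (Xa * Gm * Xr * z / ((Yq * v1) * (Yr * v3) * (Q1 * v2) * a1)) / z * (v3 * v1 * v2)"
  using assms by (simp add: mult_ac)

text \<open>The explicit form of B is what the leading factors of the downward symbols, with one
  power of q, contribute to the summand; the weight of the downward series is therefore free of B.
  That weight, \<open>rprod S a / ((1 - a) * (1 - a / q))\<close>, is formally the telescoping
  sequence continued to the index -1.\<close>

lemma W10_9_shift_relation:
  fixes q a g A B C :: complex and S :: "complex list"
  assumes q: "q \<noteq> 0" "norm q < 1"
    and nz: "a \<noteq> 0" "g \<noteq> 0" "\<forall>p\<in>set S. p \<noteq> 0" "a \<noteq> q"
    and ns: "W10_9_nonsingular q a (g # S)"
      "W10_9_nonsingular q (a * q\<^sup>2) (g # map (\<lambda>p. p * q) S)"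
      "W10_9_nonsingular q (a / q\<^sup>2) (g # map (\<lambda>p. p / q) S)"
    and B: "B = q * pprod S (1 / q) / ((1 - a / (g * q)) * (1 - a / g))"
    and start: "pprod S 1 * (1 - a / q) * (1 - g / q) - rprod S a * (1 - q) * (1 - a * q / g)
      = (1 - a) * (1 - a * q / g) * (B * (1 - g) * (1 - a / g) + C * (1 - a / q) * (1 - q))"
    and step: "\<And>z. z \<noteq> 0 \<Longrightarrow>
      (1 - g / q) * (pprod S z * (1 - a * z / q) * (1 - g * z / q)
           - rprod S (a * z) * (1 - q * z) * (1 - a * q * z / g))
      = (1 - a * z\<^sup>2) * z *
        (A * (1 - a * z) * (1 - z) * (1 - a * z / q) * (1 - q * z)
         + B * (1 - g * z) * (1 - a * z / g) * (1 - g * z / q) * (1 - a * q * z / g)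
         + C * (1 - g * z / q) * (1 - a * q * z / g) * (1 - a * z / q) * (1 - q * z))"
  shows "A * (q * (1 - a * q) * (1 - a * q\<^sup>2) * pprod S 1
              / ((1 - a * q / g) * (1 - a * q\<^sup>2 / g) * rprod S (a * q)))
           * W10_9 q (a * q\<^sup>2) (g # map (\<lambda>p. p * q) S)
         + rprod S a / ((1 - a) * (1 - a / q)) * W10_9 q (a / q\<^sup>2) (g # map (\<lambda>p. p / q) S)
         + C * W10_9 q a (g # S)
       = (1 - g / q) / (1 - a) * (qpoch_inf q a * qpoch_inf q g * qpochs_inf q S)
         / (qpoch_inf q q * qpoch_inf q (a * q / g) * qpochs_inf q (map (\<lambda>p. a * q / p) S))"
proof -
  let ?S = "map (\<lambda>p. a * q / p) S"
  define cp where "cp = q * (1 - a * q) * (1 - a * q\<^sup>2) * pprod S 1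
              / ((1 - a * q / g) * (1 - a * q\<^sup>2 / g) * rprod S (a * q))"
  define cm where "cm = rprod S a / ((1 - a) * (1 - a / q))"
  define tp where "tp = wterm q (a * q\<^sup>2) (g # map (\<lambda>p. p * q) S)"
  define tm where "tm = wterm q (a / q\<^sup>2) (g # map (\<lambda>p. p / q) S)"
  define t0 where "t0 = wterm q a (g # S)"
  define F where "F k = (1 - g / q) / (1 - a) * (qpoch q a k * qpoch q g k * qpochs q S (Suc k))
      / (qpoch q q (Suc k) * qpoch q (a * q / g) (Suc k) * qpochs q ?S k)" for k
  have a1: "1 - a \<noteq> 0" and a2: "1 - a * q\<^sup>2 \<noteq> 0" and a_2: "1 - a / q\<^sup>2 \<noteq> 0" and a_1: "1 - a / q \<noteq> 0"
    using W10_9_nonsingularD(1)[OF ns(1)] W10_9_nonsingularD(1)[OF ns(2)]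
      W10_9_nonsingularD(1)[OF ns(3)] nz q by (simp_all add: eq_commute[of q a])
  have S_up: "map (\<lambda>p. a * q\<^sup>2 * q / p) (map (\<lambda>p. p * q) S) = map (\<lambda>p. p * q) ?S"
    and S_down: "map (\<lambda>p. a / q\<^sup>2 * q / p) (map (\<lambda>p. p / q) S) = map (\<lambda>p. a / p) S"
    using q by (simp_all add: power2_eq_square)
  have g_down: "a / q\<^sup>2 * q / g = a / (g * q)" and g_up: "a * q\<^sup>2 * q / g = a * q / g * q * q"
    using q by (simp_all add: power2_eq_square)
  have nq: "qpoch q q k \<noteq> 0" and nS: "qpochs q ?S k \<noteq> 0"
    and ng: "qpoch q (a * q / g) k \<noteq> 0" and nS': "qpochs q (map (\<lambda>p. a / p) S) k \<noteq> 0"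
    and ng': "qpoch q (a / (g * q)) k \<noteq> 0" for k
    using W10_9_nonsingularD(2,3)[OF ns(1), of k]
      W10_9_nonsingularD(3)[OF ns(3), of k] q
    unfolding list.map S_down g_down by simp_all
  have Ra: "rprod S a \<noteq> 0" and g1: "1 - a * q / g \<noteq> 0" and g0: "1 - a / (g * q) \<noteq> 0" "1 - a / g \<noteq> 0"
    and q1: "1 - q \<noteq> 0"
    using nS'[of 1] ng[of 1] ng'[of 2] nq[of 1] q
    by (simp_all add: qpochs_Suc pprod_map_div numeral_2_eq_2 qpoch_Suc)
  \<comment> \<open>At z = 1 the upward series has no summand yet and the downward one contributes
    index 1. Its summand of index 0 is left over; as \<open>tm 0 = 1\<close>, it supplies
    \<open>cm\<close>, which takes the place of a value of F at -1.\<close>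
  have start': "cm * (tm 0 + tm 1) + C * t0 0 = F 0"
  proof -
    have "cm * (1 + (1 - a) / (1 - a / q\<^sup>2) * ((1 - a / q\<^sup>2) * ((1 - g) * pprod S (1 / q))
        / ((1 - q) * ((1 - a / (g * q)) * rprod S a))) * q) + C
      = (1 - g / q) / (1 - a) * pprod S 1 / ((1 - q) * (1 - a * q / g))"
      unfolding cm_def
      by (rule shift_start_term[OF _ a_1 q1 g1 a1 g0 Ra a_2]) (use start[unfolded B] in simp)
    moreover have "tm 1 = (1 - a) / (1 - a / q\<^sup>2) * ((1 - a / q\<^sup>2) * ((1 - g) * pprod S (1 / q))
        / ((1 - q) * ((1 - a / (g * q)) * rprod S a))) * q"
      unfolding tm_def wterm_def list.map S_down g_down qpochs_simps
      using q by (simp add: qpoch_Suc qpochs_Suc pprod_map_div pprod_map_divide)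
    moreover have "tm 0 = 1" "t0 0 = 1"
      using a1 a_2 by (simp_all add: tm_def t0_def wterm_def)
    moreover have "F 0 = (1 - g / q) / (1 - a) * pprod S 1 / ((1 - q) * (1 - a * q / g))"
      by (simp add: F_def qpoch_Suc qpochs_Suc)
    ultimately show ?thesis
      by (simp only: mult_1_right)
  qed
  \<comment> \<open>z = q^(m+1) pairs index m of the upward, m + 1 of the unshifted and m + 2 of the
    downward series.\<close>
  have step': "A * cp * tp m + cm * tm (Suc (Suc m)) + C * t0 (Suc m) = F (Suc m) - F m" for m
  proof -
    define z where "z = q ^ Suc m"
    have z: "z \<noteq> 0" using q by (simp add: z_def)
    have zm: "x * q ^ m = x * z / q" for x using q by (simp add: z_def)
    define V where "V = qpoch q a m * qpoch q g m * qpochs q S (Suc m) * z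
       / (qpoch q q (Suc (Suc m)) * qpochs q ?S (Suc m) * qpoch q (a * q / g) (Suc (Suc m)) * (1 - a))"
    have a_Suc: "qpoch q a (Suc m) = qpoch q a m * (1 - a * z / q)"
      and g_Suc: "qpoch q g (Suc m) = qpoch q g m * (1 - g * z / q)"
      and q_Suc: "qpoch q q (Suc (Suc m)) = qpoch q q (Suc m) * (1 - q * z)"
      and q_Suc0: "qpoch q q (Suc m) = qpoch q q m * (1 - z)"
      and ag_Suc: "qpoch q (a * q / g) (Suc (Suc m)) = qpoch q (a * q / g) (Suc m) * (1 - a * q * z / g)"
      and ag_Suc0: "qpoch q (a * q / g) (Suc m) = qpoch q (a * q / g) m * (1 - a * z / g)"
      and S_Suc: "qpochs q S (Suc (Suc m)) = qpochs q S (Suc m) * pprod S z"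
      and aS_Suc: "qpochs q ?S (Suc m) = qpochs q ?S m * rprod S (a * z)"
      using q by (simp_all add: qpoch_Suc qpochs_Suc zm z_def pprod_map_div del: power_Suc)
    define w where "w = 1 - a * z\<^sup>2"
    have w0: "1 - a * q ^ (2 * Suc m) = w" 
      unfolding w_def z_def by (simp only: power_mult mult.commute[of 2])
    have w1: "1 - a * q\<^sup>2 * q ^ (2 * m) = w" and w2: "1 - a / q\<^sup>2 * q ^ (2 * Suc (Suc m)) = w"
      unfolding w0[symmetric] using q by (simp_all add: power2_eq_square)
    have nonzero_last: "1 - q * z \<noteq> 0" "1 - a * q * z / g \<noteq> 0" "1 - z \<noteq> 0" "1 - a * z / g \<noteq> 0"
      "rprod S (a * z) \<noteq> 0"
      using nq[of "Suc (Suc m)"] ng[of "Suc (Suc m)"] nS[of "Suc m"]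
      unfolding q_Suc ag_Suc q_Suc0 ag_Suc0 aS_Suc by auto
    have sp: "A * cp * tp m = V * w * (A * (1 - a * z) * (1 - z) * (1 - a * z / q) * (1 - q * z))"
      unfolding tp_def wterm_def V_def cp_def list.map S_up g_up qpochs_simps w1
    proof (rule shift_up_term)
      have "(1 - a) * (1 - a * q) * qpoch q (a * q\<^sup>2) m = qpoch q a (Suc (Suc m))"
        by (simp add: qpoch_Suc' power2_eq_square mult_ac)
      also have "\<dots> = qpoch q a m * (1 - a * z / q) * (1 - a * z)"
        using q by (simp add: qpoch_Suc z_def)
      finally show "(1 - a) * (1 - a * q) * qpoch q (a * q\<^sup>2) m = qpoch q a m * (1 - a * z / q) * (1 - a * z)" .
      show "pprod S 1 * qpochs q (map (\<lambda>p. p * q) S) m = qpochs q S (Suc m)"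
        by (rule qpochs_Suc'[symmetric])
      show "qpoch q (a * q / g) (Suc (Suc m)) = (1 - a * q / g) * (1 - a * q\<^sup>2 / g) * qpoch q (a * q / g * q * q) m"
        by (simp add: qpoch_Suc' power2_eq_square mult_ac)
      show "qpochs q ?S (Suc m) = rprod S (a * q) * qpochs q (map (\<lambda>p. p * q) ?S) m"
        by (simp add: qpochs_Suc' pprod_map_div)
    qed (use q_Suc q_Suc0 nonzero_last a1 a2 in \<open>simp_all add: z_def\<close>)
    have sm: "cm * tm (Suc (Suc m)) = V * w
        * (B * (1 - g * z) * (1 - a * z / g) * (1 - g * z / q) * (1 - a * q * z / g))"
    proof -
      have e1: "qpoch q (a / q\<^sup>2) (Suc (Suc m)) = (1 - a / q\<^sup>2) * (1 - a / q) * qpoch q a m"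
        using q by (simp add: qpoch_Suc' power2_eq_square)
      have e2: "qpochs q (map (\<lambda>p. p / q) S) (Suc (Suc m)) = pprod S (1 / q) * qpochs q S (Suc m)"
        using q by (simp add: qpochs_Suc'[of q "map (\<lambda>p. p / q) S"] pprod_map_divide o_def)
      have e3: "qpoch q g (Suc (Suc m)) = qpoch q g m * (1 - g * z / q) * (1 - g * z)"
        using q by (simp add: qpoch_Suc z_def)
      have e4: "qpoch q (a / (g * q)) (Suc (Suc m)) = (1 - a / (g * q)) * (1 - a / g) * qpoch q (a * q / g) m"
        using q by (simp add: qpoch_Suc')
      have e5: "qpochs q (map (\<lambda>p. a / p) S) (Suc (Suc m)) = rprod S a * qpochs q ?S (Suc m)"
        by (simp add: qpochs_Suc'[of q "map (\<lambda>p. a / p) S"] pprod_map_div o_def)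
      have e6: "q ^ Suc (Suc m) = z * q"
        by (simp add: z_def)
      show ?thesis
        unfolding tm_def wterm_def V_def cm_def list.map S_down g_down qpochs_simps w2 B ag_Suc ag_Suc0
          e1 e2 e3 e4 e5 e6
        by (rule shift_down_term[OF a_2 a_1 nonzero_last(4,2) Ra])
    qed
    have s0: "C * t0 (Suc m) = V * w * (C * (1 - g * z / q) * (1 - a * q * z / g) * (1 - a * z / q) * (1 - q * z))"
      unfolding t0_def wterm_def V_def list.map qpochs_simps w0 a_Suc g_Suc q_Suc ag_Suc z_def[symmetric]
      by (rule shift_level_term[OF nonzero_last(1,2)])
    have F1: "F (Suc m) = (1 - g / q) * V / z * (pprod S z * (1 - a * z / q) * (1 - g * z / q))"
      using z unfolding F_def V_def a_Suc g_Suc S_Suc by (simp add: mult_ac)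
    have F0: "F m = (1 - g / q) * V / z * (rprod S (a * z) * (1 - q * z) * (1 - a * q * z / g))"
      unfolding F_def V_def q_Suc ag_Suc aS_Suc
      by (rule shift_boundary_term[OF nonzero_last(1,2,5) z])
    show ?thesis
      by (rule telescoping_step[OF _ z sp sm s0 F1 F0]) (use step[OF z] in \<open>simp add: w_def\<close>)
  qed
  have F_lim: "F \<longlonglongrightarrow> (1 - g / q) / (1 - a) * (qpoch_inf q a * qpoch_inf q g * qpochs_inf q S)
         / (qpoch_inf q q * qpoch_inf q (a * q / g) * qpochs_inf q ?S)"
    (is "_ \<longlonglongrightarrow> ?L")
    unfolding F_def using nq nS ng
    by (intro tendsto_intros LIMSEQ_Suc qpoch_tendsto qpochs_tendsto q)
       (auto simp: qpoch_inf_nonzero[OF q(2)] qpochs_inf_nonzero[OF q(2)])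
  have sums: "tp sums W10_9 q (a * q\<^sup>2) (g # map (\<lambda>p. p * q) S)" (is "_ sums ?Wp")
    "tm sums W10_9 q (a / q\<^sup>2) (g # map (\<lambda>p. p / q) S)" (is "_ sums ?Wm")
    "t0 sums W10_9 q a (g # S)" (is "_ sums ?W")
    unfolding tp_def tm_def t0_def by (intro W10_9_sums q ns)+
  have "(\<lambda>m. tm (Suc (Suc m))) sums (?Wm - tm 0 - tm 1)" "(\<lambda>m. t0 (Suc m)) sums (?W - t0 0)"
    unfolding sums_Suc_iff using sums sums_Suc_iff[of "\<lambda>m. tm (Suc m)"] by (simp_all add: sums_Suc_iff)
  then have "(\<lambda>m. A * cp * tp m + cm * tm (Suc (Suc m)) + C * t0 (Suc m))
      sums (A * cp * ?Wp + cm * (?Wm - tm 0 - tm 1) + C * (?W - t0 0))"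
    by (intro sums_add sums_mult sums)
  moreover have "(\<lambda>m. A * cp * tp m + cm * tm (Suc (Suc m)) + C * t0 (Suc m)) sums (?L - F 0)"
    unfolding step' by (rule telescope_sums[OF F_lim])
  ultimately have "A * cp * ?Wp + cm * (?Wm - tm 0 - tm 1) + C * (?W - t0 0) = ?L - F 0"
    by (rule sums_unique2)
  then show ?thesis
    unfolding cp_def[symmetric] cm_def[symmetric] start'[symmetric] by (simp add: algebra_simps)
qed

section \<open>The polynomial identity\<close>

text \<open>In the parametrisation \<open>a = q\<^sup>2 y t\<close>, \<open>g = q y\<close> all ratios that occur become monomials; the balancing
  condition then fixes the product \<open>K\<close> of the six letters.\<close>

lemma poly_identity:
  fixes q y t z :: complex
  assumes K: "K = q^7 * y^2 * t^3" and D: "D = q^5 * (1 - q*t) * (1 - q^2*t) * (1 - t) * (1 - q^2*y*t) * (1 - q*y*t) * (1 - q)"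
    and "P1 = 1 + c1 + c2 + c3 + c4 + c5 + K"
      "Ga = (q^2*y*t)^6 + c1 * (q^2*y*t)^5 + c2 * (q^2*y*t)^4 + c3 * (q^2*y*t)^3 + c4 * (q^2*y*t)^2 + c5 * (q^2*y*t) + K"
    and "Gq = q^6 + c1 * q^5 + c2 * q^4 + c3 * q^3 + c4 * q^2 + c5 * q + K"
      "GA = (q^2*t)^6 + c1 * (q^2*t)^5 + c2 * (q^2*t)^4 + c3 * (q^2*t)^3 + c4 * (q^2*t)^2 + c5 * (q^2*t) + K"
    and "Pz = 1 + c1 * z + c2 * z^2 + c3 * z^3 + c4 * z^4 + c5 * z^5 + K * z^6"
      "Gz = (q^2*y*t*z)^6 + c1 * (q^2*y*t*z)^5 + c2 * (q^2*y*t*z)^4 + c3 * (q^2*y*t*z)^3 + c4 * (q^2*y*t*z)^2 + c5 * (q^2*y*t*z) + K"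
    and DA: "DA = y^2 * GA * q^5 * (1 - t) * (1 - q^2*y*t) * (1 - q*y*t) * (1 - q)"
    and DC: "DC = (q^5 * (1 - t) * (P1 * K * (1 - q*y*t) * (1 - y) - Ga * (1 - q) * (1 - q^2*t)) - K * Gq * (1 - q*y)
      * (1 - q^2*y*t) * (1 - q^2*t)) * (1 - q*t)"
    and DB: "DB = Gq * K * (1 - q^2*t) * (1 - q^2*y*t) * (1 - q*y*t) * (1 - q)"
  shows "D * (1 - y) * (K * Pz * (1 - q*y*t*z) * (1 - y*z) - Gz * (1 - q*z) * (1 - q^2*t*z)) =
   (1 - q^2*y*t*z^2) * z * (DA * (1 - q^2*y*t*z) * (1 - z) * (1 - q*y*t*z) * (1 - q*z)
    + DB * (1 - q*y*z) * (1 - q*t*z) * (1 - y*z) * (1 - q^2*t*z)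
    + DC * (1 - y*z) * (1 - q^2*t*z) * (1 - q*y*t*z) * (1 - q*z))"
  unfolding assms by algebra

text \<open>The value z = 1/(q t) of \<open>poly_identity\<close>, where 1 - q t z = 0 removes the
  \<open>DB\<close> summand. Both sides then carry the factor 1 - y, which is left out. For y = 1
  the specialisation would only say 0 = 0, hence a separate proof.\<close>

lemma poly_identity_reflected:
  fixes q y t :: complex
  assumes K: "K = q^7 * y^2 * t^3" and D: "D = q^5 * (1 - q*t) * (1 - q^2*t) * (1 - t) * (1 - q^2*y*t) * (1 - q*y*t) * (1 - q)"
    and "P1 = 1 + c1 + c2 + c3 + c4 + c5 + K"
      "Ga = (q^2*y*t)^6 + c1 * (q^2*y*t)^5 + c2 * (q^2*y*t)^4 + c3 * (q^2*y*t)^3 + c4 * (q^2*y*t)^2 + c5 * (q^2*y*t) + K"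
    and "Gq = q^6 + c1 * q^5 + c2 * q^4 + c3 * q^3 + c4 * q^2 + c5 * q + K"
      "GA = (q^2*t)^6 + c1 * (q^2*t)^5 + c2 * (q^2*t)^4 + c3 * (q^2*t)^3 + c4 * (q^2*t)^2 + c5 * (q^2*t) + K"
    and "Gt = (q*t)^6 + c1 * (q*t)^5 + c2 * (q*t)^4 + c3 * (q*t)^3 + c4 * (q*t)^2 + c5 * (q*t) + K"
      "Gg = (q*y)^6 + c1 * (q*y)^5 + c2 * (q*y)^4 + c3 * (q*y)^3 + c4 * (q*y)^2 + c5 * (q*y) + K"
    and DA: "DA = y^2 * GA * q^5 * (1 - t) * (1 - q^2*y*t) * (1 - q*y*t) * (1 - q)"
    and DC: "DC = (q^5 * (1 - t) * (P1 * K * (1 - q*y*t) * (1 - y) - Ga * (1 - q) * (1 - q^2*t)) - K * Gq * (1 - q*y)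
      * (1 - q^2*y*t) * (1 - q^2*t)) * (1 - q*t)"
  shows "t * D * (K * Gt * (1 - y) * (q*t - y) * t - Gg * (t - 1) * (1 - q) * (q*t)^7) =
  (t - y) * (q*t)^5 * (DA * (1 - q*y) * (q*t - 1) * (t - 1) + DC * (q*t - y) * (1 - q) * (t - 1))"
  unfolding assms by algebra

text \<open>The value z = w of \<open>poly_identity\<close> when one of the six letters is p = a w,
  a = q^2 y t. The second boundary product contains 1 - a w/p = 0, and the common factors w, 1 - p w
  and 1 - p/q are left out. d1, ..., d5 belong to the other five letters; m = y/w keeps the
  balancing condition, which determines d5, polynomial.\<close>

lemma poly_identity_distinguished:
  fixes q y t w :: complex
  assumes y: "y = w * m" and d5: "d5 = - (q^5 * m * t^2)" and K: "K = - ((q^2*y*t*w) * d5)" and D: "D = q^5 * (1 - q*t)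
    * (1 - q^2*t) * (1 - t) * (1 - q^2*y*t) * (1 - q*y*t) * (1 - q)"
    and "P1 = (1 - (q^2*y*t*w)) * (1 + d1 + d2 + d3 + d4 + d5)"
      "Ga = (q^2*y*t - (q^2*y*t*w)) * ((q^2*y*t)^5 + d1 * (q^2*y*t)^4 + d2 * (q^2*y*t)^3 + d3 * (q^2*y*t)^2 + d4 * (q^2*y*t) + d5)"
    and "Gq = (q - (q^2*y*t*w)) * (q^5 + d1 * q^4 + d2 * q^3 + d3 * q^2 + d4 * q + d5)"
      "GA = (q^2*t - (q^2*y*t*w)) * ((q^2*t)^5 + d1 * (q^2*t)^4 + d2 * (q^2*t)^3 + d3 * (q^2*t)^2 + d4 * (q^2*t) + d5)"
    and DA: "DA = y^2 * GA * q^5 * (1 - t) * (1 - q^2*y*t) * (1 - q*y*t) * (1 - q)"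
    and DC: "DC = (q^5 * (1 - t) * (P1 * K * (1 - q*y*t) * (1 - y) - Ga * (1 - q) * (1 - q^2*t)) - K * Gq * (1 - q*y)
      * (1 - q^2*y*t) * (1 - q^2*t)) * (1 - q*t)"
    and "Rw = 1 + d1 * w + d2 * w^2 + d3 * w^3 + d4 * w^4 + d5 * w^5" "Rq = q^5 + d1 * q^4 + d2 * q^3 + d3 * q^2 + d4 * q + d5"
    and DB: "DB = q * Rq * K * (1 - q^2*t) * (1 - q^2*y*t) * (1 - q*y*t) * (1 - q)"
  shows "D * (- (q^2*y*t*d5)) * (1 - y) * Rw * (1 - y*w) = DA * (1 - (q^2*y*t*w)) * (1 - w) * (1 - q*w)
   + DB * (1 - q*y*w) * (1 - q*t*w) * (1 - y*w) * (1 - q^2*t*w) + DC * (1 - y*w) * (1 - q^2*t*w) * (1 - q*w)"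
  unfolding assms by algebra

text \<open>\<open>DC\<close> is symmetric in the six letters, whereas the bracket in the theorem
  distinguishes h. Here h = q^2 y t w is split off, and the three summands of the bracket, cleared
  of denominators, are matched with \<open>DC\<close>.\<close>

lemma poly_identity_statement:
  fixes q y t w :: complex
  assumes y: "y = w * m" and d5: "d5 = - (q^5 * m * t^2)" and K: "K = - ((q^2*y*t*w) * d5)" and D: "D = q^5 * (1 - q*t)
    * (1 - q^2*t) * (1 - t) * (1 - q^2*y*t) * (1 - q*y*t) * (1 - q)"
    and "P1 = (1 - (q^2*y*t*w)) * (1 + d1 + d2 + d3 + d4 + d5)"
      "Ga = (q^2*y*t - (q^2*y*t*w)) * ((q^2*y*t)^5 + d1 * (q^2*y*t)^4 + d2 * (q^2*y*t)^3 + d3 * (q^2*y*t)^2 + d4 * (q^2*y*t) + d5)"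
    and "Gq = (q - (q^2*y*t*w)) * (q^5 + d1 * q^4 + d2 * q^3 + d3 * q^2 + d4 * q + d5)"
      "GA = (q^2*t - (q^2*y*t*w)) * ((q^2*t)^5 + d1 * (q^2*t)^4 + d2 * (q^2*t)^3 + d3 * (q^2*t)^2 + d4 * (q^2*t) + d5)"
    and DA: "DA = y^2 * GA * q^5 * (1 - t) * (1 - q^2*y*t) * (1 - q*y*t) * (1 - q)"
    and DC: "DC = (q^5 * (1 - t) * (P1 * K * (1 - q*y*t) * (1 - y) - Ga * (1 - q) * (1 - q^2*t)) - K * Gq * (1 - q*y)
      * (1 - q^2*y*t) * (1 - q^2*t)) * (1 - q*t)"
    and "R1 = 1 + d1 + d2 + d3 + d4 + d5" "Rt = (q*t)^5 + d1 * (q*t)^4 + d2 * (q*t)^3 + d3 * (q*t)^2 + d4 * (q*t) + d5"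
    and "Rw = q^5 + d1 * q^4 * w + d2 * q^3 * w^2 + d3 * q^2 * w^3 + d4 * q * w^4 + d5 * w^5"
  shows "D * K * (q * w^2 * (1 - q*t*w) * (1 - y*w) * R1 * (t*w - 1) * (1 - t) * d5
   + q^2 * y * w * (1 - q^2*t) * (w - 1) * (w - q) * (1 - q*y*t*w) * Rt
   - q^2 * y * t^2 * (1 - q*y) * (1 - q*t) * (1 - q^2*t) * (1 - t) * Rw)
   = q * (w - q) * w^2 * (t*w - 1) * (1 - t) * d5 * (1 - q*t) * (1 - q^2*t) * DC"
  unfolding assms by algebra

section \<open>The products over the letters as polynomials\<close>

definition poly_of :: "complex list \<Rightarrow> complex poly" where
  "poly_of S = (\<Prod>p\<leftarrow>S. [:1, - p:])"

lemma poly_of_simps [simp]: "poly_of [] = 1" "poly_of (p # S) = [:1, - p:] * poly_of S"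
  by (simp_all add: poly_of_def)

lemma poly_poly_of: "poly (poly_of S) x = pprod S x"
  by (induction S) (auto simp: algebra_simps)

lemma coeff_poly_of_0: "coeff (poly_of S) 0 = 1"
  by (induction S) (auto simp: coeff_mult_0)

lemma poly_of_nonzero: "poly_of S \<noteq> 0"
  using coeff_poly_of_0[of S] by auto

lemma degree_poly_of:
  assumes "\<forall>p\<in>set S. p \<noteq> 0"
  shows "degree (poly_of S) = length S \<and> coeff (poly_of S) (length S) = (-1) ^ length S * prod_list S"
  using assms
proof (induction S)
  case (Cons p S)
  then have deg: "degree (poly_of S) = length S" and lc: "lead_coeff (poly_of S) = (-1) ^ length S * prod_list S"
    by auto
  have "degree (poly_of (p # S)) = length (p # S)"
    using Cons.prems poly_of_nonzero[of S] deg by (simp add: degree_mult_eq del: mult_pCons_left)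
  moreover have "lead_coeff (poly_of (p # S)) = (-1) ^ length (p # S) * prod_list (p # S)"
    using Cons.prems lc unfolding poly_of_simps lead_coeff_mult by simp
  ultimately show ?case
    by simp
qed auto

lemma poly_reflect_poly_of:
  assumes "\<forall>p\<in>set S. p \<noteq> 0"
  shows "poly (reflect_poly (poly_of S)) x = (-1) ^ length S * prod_list S * rprod S x"
  using assms
proof (induction S)
  case (Cons p S)
  then have "p \<noteq> 0" and IH: "poly (reflect_poly (poly_of S)) x = (-1) ^ length S * prod_list S * rprod S x"
    by auto
  moreover have "reflect_poly [:1, - p:] = [:- p, 1:]"
    using \<open>p \<noteq> 0\<close> by (simp add: reflect_poly_def)
  ultimately show ?case
    unfolding poly_of_simps reflect_poly_mult poly_mult IH by (simp add: field_simps)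
qed auto

text \<open>Up to the product of the letters and a sign, \<open>rprod S\<close> is the reversed
  polynomial of \<open>pprod S\<close>. One coefficient sequence describes both, and the letters
  enter the polynomial identities only through it.\<close>

lemma pprod_expand:
  assumes "\<forall>p\<in>set S. p \<noteq> 0"
  obtains c where "c 0 = 1" "c (length S) = (-1) ^ length S * prod_list S"
    "\<And>x. pprod S x = (\<Sum>j\<le>length S. c j * x ^ j)"
    "\<And>x. (-1) ^ length S * prod_list S * rprod S x = (\<Sum>j\<le>length S. c (length S - j) * x ^ j)"
proof (rule that[of "coeff (poly_of S)"])
  note deg = degree_poly_of[OF assms]
  show "coeff (poly_of S) 0 = 1"
    by (rule coeff_poly_of_0)
  show "coeff (poly_of S) (length S) = (-1) ^ length S * prod_list S"
    using deg by simp
  show "pprod S x = (\<Sum>j\<le>length S. coeff (poly_of S) j * x ^ j)" for x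
    using deg by (simp flip: poly_poly_of add: poly_altdef)
  show "(-1) ^ length S * prod_list S * rprod S x
      = (\<Sum>j\<le>length S. coeff (poly_of S) (length S - j) * x ^ j)" for x
    unfolding poly_reflect_poly_of[OF assms, symmetric] poly_altdef
    using deg by (simp add: coeff_poly_of_0 coeff_reflect_poly)
qed

text \<open>The values that \<open>coef_identity\<close> forces at \<open>z = q / g\<close>, \<open>z = 1
  / q\<close> and \<open>z = 1\<close>.\<close>

definition coefA :: "complex \<Rightarrow> complex \<Rightarrow> complex \<Rightarrow> complex list \<Rightarrow> complex" where
  "coefA q a g S = (g / q)^2 * rprod S (a * q / g) / ((1 - a / g) * (1 - a * q / g))"

definition coefB :: "complex \<Rightarrow> complex \<Rightarrow> complex \<Rightarrow> complex list \<Rightarrow> complex" where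
  "coefB q a g S = q * pprod S (1 / q) / ((1 - a / (g * q)) * (1 - a / g))"

definition coefC :: "complex \<Rightarrow> complex \<Rightarrow> complex \<Rightarrow> complex list \<Rightarrow> complex" where
  "coefC q a g S =
    ((pprod S 1 * (1 - a / q) * (1 - g / q) - rprod S a * (1 - q) * (1 - a * q / g))
       / ((1 - a) * (1 - a * q / g)) - coefB q a g S * (1 - g) * (1 - a / g))
    / ((1 - a / q) * (1 - q))"

text \<open>The equation defining \<open>coefC\<close>, freed of denominators:
  \<open>coef_identity\<close> at z = 1 with 1 - g/q cancelled. It serves as the initial condition
  of the telescoping.\<close>

lemma coefC_start:
  assumes "a \<noteq> 1" "a \<noteq> q" "q \<noteq> 0" "q \<noteq> 1" "1 - a * q / g \<noteq> 0"
  shows "pprod S 1 * (1 - a / q) * (1 - g / q) - rprod S a * (1 - q) * (1 - a * q / g)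
      = (1 - a) * (1 - a * q / g)
        * (coefB q a g S * (1 - g) * (1 - a / g) + coefC q a g S * (1 - a / q) * (1 - q))"
proof -
  have "1 - a / q \<noteq> 0" "1 - q \<noteq> 0" "1 - a \<noteq> 0"
    using assms by auto
  then have "coefC q a g S * (1 - a / q) * (1 - q) =
    (pprod S 1 * (1 - a / q) * (1 - g / q) - rprod S a * (1 - q) * (1 - a * q / g))
       / ((1 - a) * (1 - a * q / g)) - coefB q a g S * (1 - g) * (1 - a / g)"
    unfolding coefC_def mult.assoc by (intro iffD1[OF nonzero_eq_divide_eq refl]) simp
  then show ?thesis
    using \<open>1 - a \<noteq> 0\<close> assms(5) by (simp del: right_minus_eq)
qed

text \<open>e1, ..., e6 stand for 1 - a/g, 1 - a q/g, 1 - a/(g q), 1 - a, 1 - a/q, 1 - q, the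
  factors in the denominators of the three coefficients. As atoms they cancel without being
  expanded.\<close>

lemma coef_cleared:
  fixes K :: complex
  assumes "q \<noteq> 0" "e1 \<noteq> 0" "e2 \<noteq> 0" "e3 \<noteq> 0" "e4 \<noteq> 0" "e5 \<noteq> 0" "e6 \<noteq> 0"
  shows "K * (q^5 * e1 * e2 * e3 * e4 * e5 * e6) * (r / (e1 * e2)) = K * r * q^5 * e3 * e4 * e5 * e6"
    and "K * (q^5 * e1 * e2 * e3 * e4 * e5 * e6) * (q * r / (e3 * e1)) = q^6 * r * K * e2 * e4 * e5 * e6"
    and "K * (q^5 * e1 * e2 * e3 * e4 * e5 * e6)
        * (((P1 * e5 * y - ra * e6 * e2) / (e4 * e2) - q * r / (e3 * e1) * g1 * e1) / (e5 * e6))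
      = (q^5 * e3 * (P1 * K * e5 * y - (K * ra) * e6 * e2) - K * (q^6 * r) * g1 * e4 * e2) * e1"
  using assms by (simp_all add: field_simps power_numeral_reduce)

text \<open>Here s = q t = a/g, and the factor K D s^7 t^2 clears the reciprocals that the argument
  z = 1/s introduces.\<close>

lemma reflected_start:
  fixes K D :: complex
  assumes "t * D * (K * (s^6 * Pt) * (1 - y) * (s - y) * t - K * Rg * (t - 1) * (1 - q) * s^7)
      = (t - y) * s^5 * (K * D * A * (1 - g) * (s - 1) * (t - 1) + K * D * C * (s - y) * (1 - q) * (t - 1))"
    and nz: "t \<noteq> 0" "s \<noteq> 0" "K \<noteq> 0" "D \<noteq> 0"
  shows "Pt * (1 - y / s) * (1 - y) - Rg * (1 - q) * (1 - 1 / t)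
    = (1 - y / t) * (1 - 1 / t) * (A / s * (1 - g) * (1 - 1 / s) + C / s * (1 - y / s) * (1 - q))"
    (is "?L = ?R")
proof -
  have "K * D * s^7 * t^2 * ?L
      = t * D * (K * (s^6 * Pt) * (1 - y) * (s - y) * t - K * Rg * (t - 1) * (1 - q) * s^7)"
    using nz by (simp add: field_simps power_numeral_reduce)
  also have "\<dots> = K * D * s^7 * t^2 * ?R"
    unfolding assms(1) using nz by (simp add: field_simps power_numeral_reduce)
  finally have "K * D * s^7 * t^2 * ?L = K * D * s^7 * t^2 * ?R" .
  moreover have "K * D * s^7 * t^2 \<noteq> 0"
    using nz by simp
  ultimately show ?thesis
    by (metis mult_cancel_left)
qed

lemma distinguished_start:
  fixes K D :: complex
  assumes "D * (- (u * d5)) * (1 - y) * Rw * x = K * D * A * p' * w' * v1 + K * D * B * g' * s' * x * v2 + K * D * C * x * v2 * v1"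
    and "K = - (u * w * d5)" and nz: "w \<noteq> 0" "K \<noteq> 0" "D \<noteq> 0"
  shows "(1 - y) / w * Rw * x = A * p' * w' * v1 + B * g' * s' * x * v2 + C * x * v2 * v1"
    (is "?L = ?R")
proof -
  have "K * D * ?L = D * (- (u * d5)) * (1 - y) * Rw * x"
    unfolding assms(2) using nz(1) by (simp add: field_simps)
  also have "\<dots> = K * D * ?R"
    unfolding assms(1) by (simp add: distrib_left mult_ac)
  finally have "K * D * ?L = K * D * ?R" .
  moreover have "K * D \<noteq> 0"
    using nz by simp
  ultimately show ?thesis
    by (metis mult_cancel_left)
qed

lemma statement_form:
  fixes K D :: complex
  assumes "D * K * (q * w^2 * h1 * h2 * R1 * (t*w - 1) * t1 * d5
   + q^2 * y * w * e2 * (w - 1) * (w - q) * h3 * (d5 * Rt)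
   - q^2 * y * t^2 * g1 * e1 * e2 * t1 * (w^5 * (d5 * Rw)))
   = q * (w - q) * w^2 * (t*w - 1) * t1 * d5 * e1 * e2 * (K * D * C)"
    and nz: "w \<noteq> 0" "K \<noteq> 0" "D \<noteq> 0" "t \<noteq> 0" "t * w - 1 \<noteq> 0" "t1 \<noteq> 0" "d5 \<noteq> 0"
  shows "q / w * h1 * h2 * R1 + q^2 * y / (t * w) * ((e2 * (1 - 1 / w) * (1 - q / w) * h3 * Rt) / ((1 - 1 / (t * w)) * t1))
    - (q^2 * y * t * w * g1 * e1 * e2 * Rw) / (1 - 1 / (t * w))
    = q * (1 - q / w) * e1 * e2 * C"
    (is "?L1 + ?L2 - ?L3 = ?R")
proof -
  define x where "x = t * w - 1"
  have x: "1 - 1 / (t * w) = x / (t * w)" "x \<noteq> 0"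
    using nz by (simp_all add: x_def field_simps)
  have 1: "1 - 1 / w = (w - 1) / w" "1 - q / w = (w - q) / w"
    using nz by (simp_all add: field_simps)
  have M: "w^3 * x * t1 * d5 * ?L1 = q * w^2 * h1 * h2 * R1 * x * t1 * d5"
    "w^3 * x * t1 * d5 * ?L2 = q^2 * y * w * e2 * (w - 1) * (w - q) * h3 * (d5 * Rt)"
    "w^3 * x * t1 * d5 * ?L3 = q^2 * y * t^2 * g1 * e1 * e2 * t1 * (w^5 * (d5 * Rw))"
    "w^3 * x * t1 * d5 * ?R = q * (w - q) * w^2 * x * t1 * d5 * e1 * e2 * C"
    unfolding x 1 using nz x(2) by (simp_all add: power_numeral_reduce)
  have "D * K * (w^3 * x * t1 * d5 * ?L1 + w^3 * x * t1 * d5 * ?L2 - w^3 * x * t1 * d5 * ?L3)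
     = D * K * (w^3 * x * t1 * d5 * ?R)"
    using assms(1)[folded x_def] unfolding M by (simp only: mult_ac)
  then have "(D * K * (w^3 * x * t1 * d5)) * (?L1 + ?L2 - ?L3) = (D * K * (w^3 * x * t1 * d5)) * ?R"
    by (simp only: distrib_left right_diff_distrib mult.assoc)
  moreover have "D * K * (w^3 * x * t1 * d5) \<noteq> 0"
    using nz x(2) by simp
  ultimately show ?thesis
    by (metis mult_cancel_left)
qed

section \<open>The three coefficients in the coordinates y = g/q and t = a/(g q)\<close>

locale contiguous_parameters =
  fixes q a g y t :: complex
  assumes q: "q \<noteq> 0" "q \<noteq> 1"
    and a: "a \<noteq> 0" "a \<noteq> 1" "a \<noteq> q"
    and g: "g \<noteq> 0" "1 - a / (g * q) \<noteq> 0" "1 - a / g \<noteq> 0" "1 - a * q / g \<noteq> 0"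
    and a_eq: "a = q^2 * y * t" and g_eq: "g = q * y"
begin

text \<open>The common denominator of the three coefficients; its factors are non-zero by the
  assumptions of the locale. For six letters the power q^5, with the factor q of
  \<open>coefB\<close>, clears \<open>pprod S (1 / q)\<close>.\<close>

definition D where "D = q^5 * (1 - q*t) * (1 - q^2*t) * (1 - t) * (1 - q^2*y*t) * (1 - q*y*t) * (1 - q)"

lemma y_nonzero: "y \<noteq> 0" and t_nonzero: "t \<noteq> 0"
  using a(1) by (auto simp: a_eq)

lemma quotients:
  "a / g = q * t" "a * q / g = q^2 * t" "a / (g * q) = t" "a / q = q * y * t" "g / q = y"
  using q y_nonzero by (simp_all add: a_eq g_eq power2_eq_square)

lemma quotients_times:
  "a * z / q = q * y * t * z" "g * z / q = y * z" "a * z / g = q * t * z" "a * q * z / g = q^2 * t * z"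
  using q y_nonzero by (simp_all add: a_eq g_eq power2_eq_square)

lemma factors_nonzero:
  "1 - q * t \<noteq> 0"
    "1 - q^2 * t \<noteq> 0"
    "1 - t \<noteq> 0"
    "1 - q^2 * y * t \<noteq> 0"
    "1 - q * y * t \<noteq> 0"
    "1 - q \<noteq> 0"
  using q a(2,3) g(2-4) unfolding quotients by (simp_all add: a_eq power2_eq_square mult.assoc)

lemma D_nonzero: "D \<noteq> 0"
  using q factors_nonzero by (simp add: D_def)

lemma coef_products:
  "K * D * coefA q a g S = y^2 * (K * rprod S (q^2 * t)) * q^5 * (1 - t) * (1 - q^2*y*t) * (1 - q*y*t) * (1 - q)"
  "K * D * coefB q a g S = q^6 * pprod S (1 / q) * K * (1 - q^2*t) * (1 - q^2*y*t) * (1 - q*y*t) * (1 - q)"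
  "K * D * coefC q a g S =
    (q^5 * (1 - t) * (pprod S 1 * K * (1 - q*y*t) * (1 - y) - K * rprod S (q^2*y*t) * (1 - q) * (1 - q^2*t))
     - K * (q^6 * pprod S (1 / q)) * (1 - q*y) * (1 - q^2*y*t) * (1 - q^2*t)) * (1 - q*t)"
proof -
  note cleared = coef_cleared[OF q(1) factors_nonzero]
  show "K * D * coefA q a g S = y^2 * (K * rprod S (q^2 * t)) * q^5 * (1 - t) * (1 - q^2*y*t) * (1 - q*y*t) * (1 - q)"
    unfolding D_def coefA_def quotients cleared by (simp add: mult_ac)
  show "K * D * coefB q a g S = q^6 * pprod S (1 / q) * K * (1 - q^2*t) * (1 - q^2*y*t) * (1 - q*y*t) * (1 - q)"
    unfolding D_def coefB_def quotients by (rule cleared)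
  show "K * D * coefC q a g S =
    (q^5 * (1 - t) * (pprod S 1 * K * (1 - q*y*t) * (1 - y) - K * rprod S (q^2*y*t) * (1 - q) * (1 - q^2*t))
     - K * (q^6 * pprod S (1 / q)) * (1 - q*y) * (1 - q^2*y*t) * (1 - q^2*t)) * (1 - q*t)"
    unfolding D_def coefB_def coefC_def quotients unfolding a_eq g_eq by (rule cleared)
qed

text \<open>The second conclusion is the first at \<open>z = g / a\<close> with a factor \<open>1 - g / q\<close> cancelled. This starts the
  telescoping also when \<open>g = q\<close>.\<close>

lemma coef_identity:
  assumes S: "length S = 6" "\<forall>p\<in>set S. p \<noteq> 0" "prod_list S * g = a^3 * q\<^sup>2"
  shows "(1 - g / q) * (pprod S z * (1 - a * z / q) * (1 - g * z / q)
           - rprod S (a * z) * (1 - q * z) * (1 - a * q * z / g))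
      = (1 - a * z\<^sup>2) * z *
        (coefA q a g S * (1 - a * z) * (1 - z) * (1 - a * z / q) * (1 - q * z)
         + coefB q a g S * (1 - g * z) * (1 - a * z / g) * (1 - g * z / q) * (1 - a * q * z / g)
         + coefC q a g S * (1 - g * z / q) * (1 - a * q * z / g) * (1 - a * z / q) * (1 - q * z))"
    (is "?L = _ * _ * (coefA q a g S * ?x1 * ?x2 * ?x3 * ?x4 + coefB q a g S * ?y1 * ?y2 * ?y3 * ?y4
      + coefC q a g S * ?z1 * ?z2 * ?z3 * ?z4)")
    and "pprod S (g / a) * (1 - y / (q * t)) * (1 - g / q) - rprod S g * (1 - q) * (1 - 1 / t)
      = (1 - y / t) * (1 - 1 / t) *
        (coefA q a g S * g / a * (1 - g) * (1 - g / a) + coefC q a g S * g / a * (1 - y / (q * t)) * (1 - q))"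
proof -
  define K where "K = prod_list S"
  obtain c where "c 0 = 1" "c 6 = K" "\<And>x. pprod S x = (\<Sum>j\<le>6. c j * x ^ j)"
    "\<And>x. K * rprod S x = (\<Sum>j\<le>6. c (6 - j) * x ^ j)"
    using pprod_expand[OF S(2)] unfolding S(1) K_def by auto
  then have pp: "pprod S x = 1 + c 1 * x + c 2 * x^2 + c 3 * x^3 + c 4 * x^4 + c 5 * x^5 + K * x^6"
    and rp: "K * rprod S x = x^6 + c 1 * x^5 + c 2 * x^4 + c 3 * x^3 + c 4 * x^2 + c 5 * x + K" for x
    by (simp_all add: eval_nat_numeral)
  have K: "K = q^7 * y^2 * t^3"
    using S(3) g q y_nonzero unfolding K_def[symmetric] a_eq g_eq by (simp add: field_simps power_numeral_reduce)
  have K0: "K \<noteq> 0"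
    using y_nonzero t_nonzero q by (simp add: K)
  have p1: "pprod S 1 = 1 + c 1 + c 2 + c 3 + c 4 + c 5 + K"
    by (simp add: pp)
  have pq: "q^6 * pprod S (1 / q) = q^6 + c 1 * q^5 + c 2 * q^4 + c 3 * q^3 + c 4 * q^2 + c 5 * q + K"
    using q by (simp add: pp field_simps power_numeral_reduce)
  have pqt: "(q*t)^6 * pprod S (1 / (q*t)) = (q*t)^6 + c 1 * (q*t)^5 + c 2 * (q*t)^4 + c 3 * (q*t)^3 + c 4 * (q*t)^2 + c 5 * (q*t) + K"
  proof -
    have "s^6 * pprod S (1 / s) = s^6 + c 1 * s^5 + c 2 * s^4 + c 3 * s^3 + c 4 * s^2 + c 5 * s + K" if "s \<noteq> 0" for s
      using that by (simp add: pp field_simps power_numeral_reduce)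
    then show ?thesis using q t_nonzero by simp
  qed
  have "K * D * ?L = D * (1 - y) * (K * pprod S z * (1 - q*y*t*z) * (1 - y*z)
      - (K * rprod S (q^2*y*t*z)) * (1 - q*z) * (1 - q^2*t*z))"
    unfolding quotients quotients_times a_eq[symmetric] by (simp add: right_diff_distrib mult_ac)
  also have "\<dots> = (1 - q^2*y*t*z^2) * z * (K * D * coefA q a g S * (1 - q^2*y*t*z) * (1 - z) * (1 - q*y*t*z) * (1 - q*z)
    + K * D * coefB q a g S * (1 - q*y*z) * (1 - q*t*z) * (1 - y*z) * (1 - q^2*t*z)
    + K * D * coefC q a g S * (1 - y*z) * (1 - q^2*t*z) * (1 - q*y*t*z) * (1 - q*z))"
    by (rule poly_identity[OF K D_def p1 rp pq rp pp rp coef_products(1,3,2)])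
  also have "\<dots> = K * D * ((1 - a * z\<^sup>2) * z * (coefA q a g S * ?x1 * ?x2 * ?x3 * ?x4 + coefB q a g S * ?y1 * ?y2 * ?y3 * ?y4
      + coefC q a g S * ?z1 * ?z2 * ?z3 * ?z4))"
    unfolding quotients quotients_times a_eq[symmetric] g_eq[symmetric] by (simp add: distrib_left mult_ac)
  finally show "?L = (1 - a * z\<^sup>2) * z * (coefA q a g S * ?x1 * ?x2 * ?x3 * ?x4 + coefB q a g S * ?y1 * ?y2 * ?y3 * ?y4
      + coefC q a g S * ?z1 * ?z2 * ?z3 * ?z4)"
    using K0 D_nonzero by simp
  have "t * D * (K * ((q*t)^6 * pprod S (1 / (q*t))) * (1 - y) * (q*t - y) * t - (K * rprod S (q * y)) * (t - 1) * (1 - q) * (q*t)^7) =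
  (t - y) * (q*t)^5 * (K * D * coefA q a g S * (1 - q*y) * (q*t - 1) * (t - 1) + K * D * coefC q a g S * (q*t - y) * (1 - q) * (t - 1))"
    by (rule poly_identity_reflected[OF K D_def p1 rp pq rp pqt rp coef_products(1,3)])
  then have "pprod S (1 / (q*t)) * (1 - y / (q * t)) * (1 - y) - rprod S (q * y) * (1 - q) * (1 - 1 / t)
      = (1 - y / t) * (1 - 1 / t) *
        (coefA q a g S / (q*t) * (1 - q*y) * (1 - 1 / (q*t)) + coefC q a g S / (q*t) * (1 - y / (q * t)) * (1 - q))"
    by (rule reflected_start) (use q t_nonzero K0 D_nonzero in simp_all)
  moreover have "g / a = 1 / (q*t)" "x * g / a = x / (q * t)" for x
    using q y_nonzero by (simp_all add: a_eq g_eq power2_eq_square)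
  ultimately show "pprod S (g / a) * (1 - y / (q * t)) * (1 - g / q) - rprod S g * (1 - q) * (1 - 1 / t)
      = (1 - y / t) * (1 - 1 / t) *
        (coefA q a g S * g / a * (1 - g) * (1 - g / a) + coefC q a g S * g / a * (1 - y / (q * t)) * (1 - q))"
    unfolding quotients by (simp only: g_eq)
qed

text \<open>The first conclusion is \<open>coef_identity\<close> at \<open>z = p / a\<close> with a factor \<open>1
  - p / q\<close> cancelled, which
  remains meaningful when \<open>p = q\<close>.\<close>

lemma distinguished_identities:
  assumes R: "length R = 5" "\<forall>p\<in>set R. p \<noteq> 0" "p * prod_list R * g = a^3 * q\<^sup>2"
    and p: "p = q^2 * y * t * w"
  shows "(1 - y) / w * pprod R w * (1 - y * w) = coefA q a g (p # R) * (1 - q^2 * y * t * w) * (1 - w) * (1 - q*w)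
    + q * pprod R (1 / q) / ((1 - t) * (1 - q * t)) * (1 - q*y*w) * (1 - q*t*w) * (1 - y*w) * (1 - q^2*t*w)
    + coefC q a g (p # R) * (1 - y*w) * (1 - q^2*t*w) * (1 - q*w)"
    and "t * w \<noteq> 1 \<Longrightarrow> q / w * (1 - q*t*w) * (1 - y*w) * pprod R 1
    + q^2 * y / (t * w) * (((1 - q^2*t) * (1 - 1 / w) * (1 - q / w) * (1 - q*y*t*w) * rprod R (q*t)) / ((1 - 1 / (t * w)) * (1 - t)))
    - (q^2 * y * t * w * (1 - q*y) * (1 - q*t) * (1 - q^2*t) * rprod R (q / w)) / (1 - 1 / (t * w))
    = q * (1 - q / w) * (1 - q*t) * (1 - q^2*t) * coefC q a g (p # R)"
proof -
  obtain d where "d 0 = 1" and d5: "d 5 = - prod_list R" and "\<And>x. pprod R x = (\<Sum>j\<le>5. d j * x ^ j)"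
    "\<And>x. - prod_list R * rprod R x = (\<Sum>j\<le>5. d (5 - j) * x ^ j)"
    using pprod_expand[OF R(2)] unfolding R(1) by auto
  then have pp: "pprod R x = 1 + d 1 * x + d 2 * x^2 + d 3 * x^3 + d 4 * x^4 + d 5 * x^5"
    and rp: "d 5 * rprod R x = x^5 + d 1 * x^4 + d 2 * x^3 + d 3 * x^2 + d 4 * x + d 5" for x
    by (simp_all add: eval_nat_numeral)
  have "p * (q * y) \<noteq> 0" "d 5 \<noteq> 0"
    using R q a unfolding g_eq d5 by auto
  then have w: "w \<noteq> 0" and p0: "p \<noteq> 0"
    by (auto simp: p)
  define m where "m = y / w"
  have y: "y = w * m"
    using w by (simp add: m_def)
  have dm: "d 5 = - (q^5 * m * t^2)"
  proof -
    have "(q^3 * y^2 * t * w) * prod_list R = (q^3 * y^2 * t * w) * (q^5 * m * t^2)"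
      using R(3) w unfolding p a_eq g_eq m_def by (simp add: field_simps power_numeral_reduce)
    then show ?thesis
      using q y_nonzero t_nonzero w by (simp add: d5)
  qed
  \<comment> \<open>The product of all six letters: p = q^2 y t w times
    \<open>- d 5\<close>.\<close>
  define K where "K = - (q^2 * y * t * w * d 5)"
  have K0: "K \<noteq> 0"
    using q y_nonzero t_nonzero w \<open>d 5 \<noteq> 0\<close> by (simp add: K_def)
  have P1: "pprod (p # R) 1 = (1 - q^2*y*t*w) * (1 + d 1 + d 2 + d 3 + d 4 + d 5)"
    by (simp add: pp p)
  have rp': "K * rprod (p # R) x = (x - q^2*y*t*w) * (x^5 + d 1 * x^4 + d 2 * x^3 + d 3 * x^2 + d 4 * x + d 5)" for x
    unfolding rp[symmetric] K_def p[symmetric] using p0 by (simp add: field_simps)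
  have pq5: "q^5 * pprod R (1 / q) = q^5 + d 1 * q^4 + d 2 * q^3 + d 3 * q^2 + d 4 * q + d 5"
    using q by (simp add: pp field_simps power_numeral_reduce)
  have pq: "q^6 * pprod (p # R) (1 / q) = (q - q^2*y*t*w) * (q^5 + d 1 * q^4 + d 2 * q^3 + d 3 * q^2 + d 4 * q + d 5)"
    unfolding pq5[symmetric] p[symmetric] using q by (simp add: field_simps power_numeral_reduce)
  have DB: "K * D * (q * pprod R (1 / q) / ((1 - t) * (1 - q * t))) = q * (q^5 * pprod R (1 / q)) * K
      * (1 - q^2*t) * (1 - q^2*y*t) * (1 - q*y*t) * (1 - q)"
    unfolding D_def coef_cleared(2)[OF q(1) factors_nonzero] by (simp add: power_numeral_reduce)
  show "(1 - y) / w * pprod R w * (1 - y * w) = coefA q a g (p # R) * (1 - q^2 * y * t * w) * (1 - w) * (1 - q*w)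
    + q * pprod R (1 / q) / ((1 - t) * (1 - q * t)) * (1 - q*y*w) * (1 - q*t*w) * (1 - y*w) * (1 - q^2*t*w)
    + coefC q a g (p # R) * (1 - y*w) * (1 - q^2*t*w) * (1 - q*w)"
    by (rule distinguished_start[OF poly_identity_distinguished[OF y dm K_def D_def P1 rp' pq rp' coef_products(1,3) pp pq5 DB] K_def w K0 D_nonzero])
  have rw: "w^5 * (d 5 * rprod R (q / w)) = q^5 + d 1 * q^4 * w + d 2 * q^3 * w^2 + d 3 * q^2 * w^3 + d 4 * q * w^4 + d 5 * w^5"
    unfolding rp using w by (simp add: field_simps power_numeral_reduce)
  have p1: "pprod R 1 = 1 + d 1 + d 2 + d 3 + d 4 + d 5"
    by (simp add: pp)
  assume tw: "t * w \<noteq> 1"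
  show "q / w * (1 - q*t*w) * (1 - y*w) * pprod R 1
    + q^2 * y / (t * w) * (((1 - q^2*t) * (1 - 1 / w) * (1 - q / w) * (1 - q*y*t*w) * rprod R (q*t)) / ((1 - 1 / (t * w)) * (1 - t)))
    - (q^2 * y * t * w * (1 - q*y) * (1 - q*t) * (1 - q^2*t) * rprod R (q / w)) / (1 - 1 / (t * w))
    = q * (1 - q / w) * (1 - q*t) * (1 - q^2*t) * coefC q a g (p # R)"
    by (rule statement_form[OF poly_identity_statement[OF y dm K_def D_def P1 rp' pq rp' coef_products(1,3) p1 rp rw]
        w K0 D_nonzero t_nonzero _ factors_nonzero(3) \<open>d 5 \<noteq> 0\<close>]) (use tw in simp)
qed

end

section \<open>Cancellation of the boundary terms\<close>

text \<open>The factor of the second series in \<open>Phi\<close>. The product over the letters is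
  split into four, so that each infinite product can be shifted by itself.\<close>

definition Phi_weight :: "complex \<Rightarrow> complex \<Rightarrow> complex \<Rightarrow> complex list \<Rightarrow> complex" where
  "Phi_weight q a p R = qpoch_inf q (a * q) * qpoch_inf q (p / a) / (qpoch_inf q (p\<^sup>2 * q / a) * qpoch_inf q (a / p))
     * (qpochs_inf q R * qpochs_inf q (map (\<lambda>r. p * q / r) R)
        / (qpochs_inf q (map (\<lambda>r. a * q / r) R) * qpochs_inf q (map (\<lambda>r. p * r / a) R)))"

text \<open>\<open>Phi\<close> with the distinguished letter singled out as \<open>p\<close>; the order of the others does not matter.\<close>

definition Phi_dist :: "complex \<Rightarrow> complex \<Rightarrow> complex \<Rightarrow> complex list \<Rightarrow> complex" where
  "Phi_dist q a p R = W10_9 q a (p # R)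
     + Phi_weight q a p R * W10_9 q (p\<^sup>2 / a) (p # map (\<lambda>r. p * r / a) R)"

definition Phi_dist_nonsingular :: "complex \<Rightarrow> complex \<Rightarrow> complex \<Rightarrow> complex list \<Rightarrow> bool" where
  "Phi_dist_nonsingular q a p R \<longleftrightarrow> W10_9_nonsingular q a (p # R)
       \<and> qpoch_inf q (p\<^sup>2 * q / a) \<noteq> 0 \<and> qpoch_inf q (a / p) \<noteq> 0
       \<and> qpochs_inf q (map (\<lambda>r. a * q / r) R) \<noteq> 0 \<and> qpochs_inf q (map (\<lambda>r. p * r / a) R) \<noteq> 0
       \<and> W10_9_nonsingular q (p\<^sup>2 / a) (p # map (\<lambda>r. p * r / a) R)"

lemma qpochs_inf_unfold:
  assumes "norm q < 1"
  shows "qpochs_inf q xs = pprod xs 1 * qpochs_inf q (map (\<lambda>x. x * q) xs)"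
proof (induction xs)
  case (Cons x xs)
  then show ?case
    using qpoch_inf_unfold[OF assms, of x] by simp
qed simp

lemma pprod_map_scale: "pprod (map (\<lambda>r. x * r / w) S) z = pprod S (x * z / w)"
  by (induction S) (auto simp: mult_ac)

lemma rprod_map_scale: "rprod (map (\<lambda>r. x * r / w) S) z = rprod S (z * w / x)"
  by (induction S) (auto simp: mult_ac)

text \<open>Factor by factor, 1 - x/p = -(x/p)(1 - p/x). Together with the balancing condition this
  turns \<open>coefA\<close> into the \<open>coefB\<close> of the companion series when g is
  distinguished.\<close>

lemma rprod_inverse:
  assumes "\<forall>p\<in>set S. p \<noteq> 0" "x \<noteq> 0"
  shows "(-1) ^ length S * prod_list S * rprod S x = x ^ length S * pprod S (1 / x)"
  using assms(1)
proof (induction S)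
  case (Cons p S)
  have "(-1) ^ length (p # S) * prod_list (p # S) * rprod (p # S) x
      = - p * (1 - x / p) * ((-1) ^ length S * prod_list S * rprod S x)"
    by simp
  also have "\<dots> = x * (1 - p / x) * (x ^ length S * pprod S (1 / x))"
    using Cons assms(2) by (simp add: field_simps)
  finally show ?case
    by simp
qed simp

section \<open>A shifted letter is distinguished\<close>

lemma weight_up:
  fixes q n1 :: complex
  assumes "q * p2 * a0 = w * ap"
    and "ap \<noteq> 0"
    "a0 \<noteq> 0"
    "g1 \<noteq> 0"
    "g2 \<noteq> 0"
    "RR \<noteq> 0"
    "k \<noteq> 0"
    "k2 \<noteq> 0"
  shows "q * n1 * n2 * (p1 * PR) / (g1 * g2 * (ap * RR))
      * (Aq3 * (p2 * P) / (X * Y) * (g * Rq * (Gq2 * Z) / (Ag3 * U * ((k2 * PG) * T))))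
    = n1 * (n2 * Aq3) * P / (X * (a0 * Y))
      * (g * (PR * Rq) * ((k * Gq2) * Z) / ((g1 * (g2 * Ag3)) * (RR * U) * (PG * T))) * (p1 * w / (k2 * k))"
proof -
  have w: "w = q * p2 * a0 / ap"
    using assms by (simp add: eq_divide_eq)
  show ?thesis
    unfolding w using assms(2-) by (simp add: mult_ac)
qed

lemma weight_down:
  fixes q n1 :: complex
  assumes "a0 * v = q * p0 * x" and "p0 \<noteq> 0" "x \<noteq> 0" "v \<noteq> 0" "n1 \<noteq> 0" "n2 \<noteq> 0"
    "h1 \<noteq> 0" "h2 \<noteq> 0" "RR \<noteq> 0" "k2 \<noteq> 0"
  shows "a0 * RR / (n1 * n2)
      * (n2 * (n1 * Aq) * Pq / (X * (x * Y)) * (g * (PR * R) * (k * Gq * Z) / (h1 * (h2 * Ag) * (RR * U) * (PGq * T))))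
    = Aq * (p0 * Pq) / (X * Y)
      * (g * R * (Gq * Z) / (Ag * U * ((k2 * PGq) * T))) * (q * PR / (h1 * h2) * k2 * k / v)"
proof -
  have a0: "a0 = q * p0 * x / v"
    using assms by (simp add: eq_divide_eq)
  show ?thesis
    unfolding a0 using assms(2-) by (simp add: mult_ac)
qed

lemma weight_boundary:
  fixes l n1 :: complex
  assumes "w * p0 = - a0"
    and "n1 \<noteq> 0"
    "n2 \<noteq> 0"
    "X \<noteq> 0"
    "a0 \<noteq> 0"
    "PG \<noteq> 0"
    "T \<noteq> 0"
    "Gq \<noteq> 0"
    "Z \<noteq> 0"
    "Pq \<noteq> 0"
  shows "l / n1 * (n1 * Aq * g * (p * R)) / (Q * Ag * (Y * U))
     + Aq * (p0 * Pq) / (X * (a0 * Y)) * (g * R * (Gq * Z) / (Ag * U * (PG * T)))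
       * (w * l / n2 * (n2 * X * p * PG * T) / (Q * Pq * Gq * Z)) = 0"
proof -
  have "w * p0 / a0 = -1"
    using assms by simp
  moreover have "Aq * (p0 * Pq) / (X * (a0 * Y)) * (g * R * (Gq * Z) / (Ag * U * (PG * T)))
       * (w * l / n2 * (n2 * X * p * PG * T) / (Q * Pq * Gq * Z)) = (w * p0 / a0) * (l * Aq * g * p * R / (Q * Ag * Y * U))"
    using assms(2-) by (simp add: mult_ac)
  ultimately show ?thesis
    using assms(2) by (simp add: mult_ac)
qed

lemma W10_9_nonsingular_inf:
  assumes "norm q < 1" "W10_9_nonsingular q a ps"
  shows "qpoch_inf q q \<noteq> 0" "qpochs_inf q (map (\<lambda>p. a * q / p) ps) \<noteq> 0"
  by (rule qpoch_inf_nonzero[OF assms(1) W10_9_nonsingularD(2)[OF assms(2)]]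
      qpochs_inf_nonzero[OF assms(1) W10_9_nonsingularD(3)[OF assms(2)]])+

lemma W10_9_mset:
  assumes "mset ps = mset qs"
  shows "W10_9 q a ps = W10_9 q a qs" "W10_9_nonsingular q a ps = W10_9_nonsingular q a qs"
proof -
  have "qpochs q (map f ps) k = qpochs q (map f qs) k" for f :: "complex \<Rightarrow> complex" and k
    using assms unfolding qpochs_def prod_mset_prod_list[symmetric] mset_map by simp
  note perm = this this[of "\<lambda>x. x", unfolded list.map_ident]
  show "W10_9 q a ps = W10_9 q a qs" "W10_9_nonsingular q a ps = W10_9_nonsingular q a qs"
    unfolding W10_9_def W10_9_nonsingular_def qpochs_simps perm(2)[of _] perm(1) by simp_all
qed

lemma W10_9_swap:
  "W10_9 q a (x # y # R) = W10_9 q a (y # x # R)"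
  "W10_9_nonsingular q a (x # y # R) = W10_9_nonsingular q a (y # x # R)"
  by (auto intro!: W10_9_mset)

text \<open>By the last two hypotheses, M times the relation for the companion series has exactly
  the coefficients with which these series enter the shifted functions, so it can be added to the
  first relation.\<close>

lemma combine_series:
  fixes A :: complex
  assumes "A * k * Wp + m * Wm + C * W = L"
    and "A * x * y / z * Vp + B * Vm + C * V = L'" and "L + M * L' = 0"
    and "k * Mp = M * (x * y / z)" and "m * Mm = M * B"
  shows "A * k * (Wp + Mp * Vp) + m * (Wm + Mm * Vm) + C * (W + M * V) = 0"
proof -
  have "A * k * (Wp + Mp * Vp) + m * (Wm + Mm * Vm) + C * (W + M * V)
    = (A * k * Wp + m * Wm + C * W) + (A * (k * Mp) * Vp + (m * Mm) * Vm + M * (C * V))"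
    by (simp add: algebra_simps)
  also have "\<dots> = L + M * L'"
    unfolding assms(1,4,5) assms(2)[symmetric] by (simp add: algebra_simps)
  finally show ?thesis
    using assms(3) by simp
qed

lemma contiguous_distinguished_letter:
  fixes q a g p :: complex and R :: "complex list"
  assumes q: "q \<noteq> 0" "norm q < 1"
    and nz: "a \<noteq> 0" "g \<noteq> 0" "p \<noteq> 0" "\<forall>r\<in>set R. r \<noteq> 0" and a: "a \<noteq> q"
    and R: "length R = 5" "p * prod_list R * g = a^3 * q\<^sup>2"
    and ns0: "Phi_dist_nonsingular q a p (g # R)"
    and nsp: "Phi_dist_nonsingular q (a * q\<^sup>2) (p * q) (g # map (\<lambda>r. r * q) R)"
    and nsm: "Phi_dist_nonsingular q (a / q\<^sup>2) (p / q) (g # map (\<lambda>r. r / q) R)"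
  defines "S \<equiv> p # R"
  shows "coefA q a g S * (q * (1 - a * q) * (1 - a * q\<^sup>2) * pprod S 1
              / ((1 - a * q / g) * (1 - a * q\<^sup>2 / g) * rprod S (a * q)))
           * Phi_dist q (a * q\<^sup>2) (p * q) (g # map (\<lambda>r. r * q) R)
       + rprod S a / ((1 - a) * (1 - a / q)) * Phi_dist q (a / q\<^sup>2) (p / q) (g # map (\<lambda>r. r / q) R)
       + coefC q a g S * Phi_dist q a p (g # R) = 0"
proof -
  define k where "k = q * (1 - a * q) * (1 - a * q\<^sup>2) * pprod S 1
              / ((1 - a * q / g) * (1 - a * q\<^sup>2 / g) * rprod S (a * q))"
  define m where "m = rprod S a / ((1 - a) * (1 - a / q))"
  define G where "G = p * g / a"
  define R' where "R' = map (\<lambda>r. p * r / a) R"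
  define a' where "a' = p\<^sup>2 / a"
  note unfold_inf = qpoch_inf_unfold[OF q(2)] qpochs_inf_unfold[OF q(2)]
  have up: "(p * q)\<^sup>2 / (a * q\<^sup>2) = a'"
    "map (\<lambda>r. p * q * r / (a * q\<^sup>2)) (g # map (\<lambda>r. r * q) R) = G / q # R'"
    using q by (simp_all add: a'_def G_def R'_def power2_eq_square)
  have down: "(p / q)\<^sup>2 / (a / q\<^sup>2) = a'"
    "map (\<lambda>r. p / q * r / (a / q\<^sup>2)) (g # map (\<lambda>r. r / q) R) = G * q # R'"
    using q by (simp_all add: a'_def G_def R'_def power2_eq_square)
  have a'_quot: "a' / p = p / a" "a' * q / p = p * q / a" "a' / G = p / g" "a' * q / G = p * q / g"
    "map (\<lambda>r. a' * q / r) R' = map (\<lambda>r. p * q / r) R"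
    using q nz by (simp_all add: a'_def G_def R'_def power2_eq_square)
  have nonzero: "qpoch_inf q (p\<^sup>2 * q / a) \<noteq> 0" "qpoch_inf q (a / p) \<noteq> 0" "qpoch_inf q (p * g / a) \<noteq> 0"
    "qpoch_inf q (a * q / g) \<noteq> 0" "qpochs_inf q (map (\<lambda>r. a * q / r) R) \<noteq> 0"
    "qpochs_inf q (map (\<lambda>r. p * r / a) R) \<noteq> 0"
    using ns0 by (simp_all add: Phi_dist_nonsingular_def)
  have W: "W10_9_nonsingular q a (g # S)"
    "W10_9_nonsingular q (a * q\<^sup>2) (g # map (\<lambda>p. p * q) S)"
    "W10_9_nonsingular q (a / q\<^sup>2) (g # map (\<lambda>p. p / q) S)"
    and W': "W10_9_nonsingular q a' (p # G # R')" "W10_9_nonsingular q a' (p * q # G / q # R')"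
    "W10_9_nonsingular q a' (p / q # G * q # R')"
    using ns0 nsp nsm q unfolding Phi_dist_nonsingular_def up down
    by (simp_all add: W10_9_swap S_def a'_def G_def R'_def power2_eq_square)
  have W'': "qpoch_inf q (p * q / a) \<noteq> 0"
    "qpoch_inf q (p * q / g) \<noteq> 0"
    "qpochs_inf q (map (\<lambda>r. p * q / r) R) \<noteq> 0"
    "qpoch_inf q (p / g) \<noteq> 0" "qpoch_inf q q \<noteq> 0"
    using W10_9_nonsingular_inf[OF q(2) W'(1)] W10_9_nonsingular_inf[OF q(2) W'(3)] q unfolding list.map a'_quot
    by (simp_all add: a'_quot(3))
  have U: "qpoch_inf q x = (1 - x) * qpoch_inf q (x * q)" for x
    by (rule qpoch_inf_unfold[OF q(2)])
  then have U2: "qpoch_inf q x = (1 - x) * ((1 - x * q) * qpoch_inf q (x * q * q))" for x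
    by metis
  have V: "qpochs_inf q xs = pprod xs 1 * qpochs_inf q (map (\<lambda>x. x * q) xs)" for xs
    by (rule qpochs_inf_unfold[OF q(2)])
  \<comment> \<open>The infinite products of the unshifted and the upward weight are reduced to
    common ones, so that the two weights differ by finitely many factors; \<open>v\<close> does the
    same for the downward weight.\<close>
  have u: "qpoch_inf q (a * q) = (1 - a * q) * ((1 - a * q\<^sup>2) * qpoch_inf q (a * q * q * q))"
    "qpoch_inf q (p / (a * q)) = (1 - p / (a * q)) * qpoch_inf q (p / a)"
    "qpoch_inf q (a / p) = (1 - a / p) * qpoch_inf q (a * q / p)"
    "qpochs_inf q R = pprod R 1 * qpochs_inf q (map (\<lambda>r. r * q) R)"
    "qpoch_inf q (p * q / g) = (1 - p * q / g) * qpoch_inf q (p * q / g * q)"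
    "qpoch_inf q (a * q / g) = (1 - a * q / g) * ((1 - a * q\<^sup>2 / g) * qpoch_inf q (a * q / g * q * q))"
    "qpochs_inf q (map (\<lambda>r. a * q / r) R) = rprod R (a * q) * qpochs_inf q (map (\<lambda>r. a * q / r * q) R)"
    "qpoch_inf q (G / q) = (1 - G / q) * qpoch_inf q (p * g / a)"
    using U2[of "a * q"] U[of "p / (a * q)"] U[of "a / p"] V[of R] U[of "p * q / g"] U2[of "a * q / g"]
      V[of "map (\<lambda>r. a * q / r) R"] U[of "G / q"] q
    by (simp_all add: pprod_map_div power2_eq_square mult.assoc o_def G_def)
  have v: "qpoch_inf q (a / q) = (1 - a / q) * ((1 - a) * qpoch_inf q (a * q))"
    "qpoch_inf q (p / a) = (1 - p / a) * qpoch_inf q (p * q / a)"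
    "qpoch_inf q (a / (p * q)) = (1 - a / (p * q)) * qpoch_inf q (a / p)"
    "qpochs_inf q (map (\<lambda>r. r / q) R) = pprod R (1 / q) * qpochs_inf q R"
    "qpoch_inf q (p / g) = (1 - p / g) * qpoch_inf q (p * q / g)"
    "qpoch_inf q (a / (g * q)) = (1 - a / (g * q)) * ((1 - a / g) * qpoch_inf q (a * q / g))"
    "qpochs_inf q (map (\<lambda>r. a / r) R) = rprod R a * qpochs_inf q (map (\<lambda>r. a * q / r) R)"
    "qpoch_inf q (p * g / a) = (1 - G) * qpoch_inf q (G * q)"
    using U2[of "a / q"] U[of "p / a"] U[of "a / (p * q)"] V[of "map (\<lambda>r. r / q) R"] U[of "p / g"] U2[of "a / (g * q)"]
      V[of "map (\<lambda>r. a / r) R"] U[of G] q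
    by (simp_all add: pprod_map_div pprod_map_divide o_def G_def)
  have "a / q\<^sup>2 * q / g = a / (g * q)" "a / q\<^sup>2 / (p / q) = a / (p * q)" "p / q * g / (a / q\<^sup>2) = G * q"
    "p * q * g / (a * q\<^sup>2) = G / q"
    using q by (simp_all add: power2_eq_square G_def)
  then have "qpoch_inf q (a / (g * q)) \<noteq> 0" "qpoch_inf q (a / (p * q)) \<noteq> 0" "qpoch_inf q (G * q) \<noteq> 0"
    and GQ: "qpoch_inf q (G / q) \<noteq> 0" "qpoch_inf q (p * g / a) \<noteq> 0"
    using nsm nsp ns0 unfolding Phi_dist_nonsingular_def by simp_all
  moreover have "qpochs_inf q (map (\<lambda>r. a / r) R) \<noteq> 0"
    using W10_9_nonsingular_inf(2)[OF q(2) W(3)] q by (simp add: S_def o_def power2_eq_square)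
  \<comment> \<open>A non-zero infinite product has non-zero leading factors. In this way
    nonsingularity of the shifted functions controls the finite denominators.\<close>
  ultimately have down_nz: "1 - a / (g * q) \<noteq> 0" "1 - a / g \<noteq> 0" "1 - a / (p * q) \<noteq> 0" "rprod R a \<noteq> 0"
    unfolding v by auto
  have level_nz: "1 - p * q / a \<noteq> 0" "1 - p / a \<noteq> 0" "1 - a / p \<noteq> 0" "1 - a * q / p \<noteq> 0"
  proof -
    have "qpoch_inf q (a * q / p) \<noteq> 0" "1 - a / p \<noteq> 0"
      using nonzero(2) unfolding u(3) by auto
    moreover have "1 - p * q / a \<noteq> 0"
      using W''(1) U[of "p * q / a"] by auto
    ultimately show "1 - p * q / a \<noteq> 0" "1 - p / a \<noteq> 0" "1 - a / p \<noteq> 0" "1 - a * q / p \<noteq> 0"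
      using U[of "a * q / p"] by auto
  qed
  have a1: "1 - a \<noteq> 0" "1 - a / q \<noteq> 0" "1 - a' \<noteq> 0"
    using W10_9_nonsingularD(1)[OF W(1)] W10_9_nonsingularD(1)[OF W'(1)] a q by auto
  have up_nz: "1 - a * q / g \<noteq> 0"
    "1 - a * q\<^sup>2 / g \<noteq> 0"
    "rprod R (a * q) \<noteq> 0"
    "1 - p * q / g \<noteq> 0"
    "1 - G / q \<noteq> 0"
    using nonzero(4,5) W''(2) GQ(1) unfolding u by auto
  have k_weight: "k * Phi_weight q (a * q\<^sup>2) (p * q) (g # map (\<lambda>r. r * q) R)
      = Phi_weight q a p (g # R) * ((1 - p) * (1 - p / a) / ((1 - G / q) * (1 - p * q / g)))"
  proof -
    have args: "a * q\<^sup>2 * q = a * q * q * q"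
      "p * q / (a * q\<^sup>2) = p / (a * q)"
      "(p * q)\<^sup>2 * q / (a * q\<^sup>2) = p\<^sup>2 * q / a"
      "a * q\<^sup>2 / (p * q) = a * q / p"
      "map (\<lambda>r. p * q * q / r) (g # map (\<lambda>r. r * q) R) = p * q / g * q # map (\<lambda>r. p * q / r) R"
      "map (\<lambda>r. a * q * q * q / r) (g # map (\<lambda>r. r * q) R) = a * q / g * q * q # map (\<lambda>r. a * q / r * q) R"
      using q by (simp_all add: power2_eq_square)
    \<comment> \<open>From 1 - x = -x (1 - 1/x) with x = p/(a q) and x = a/p. Apart from this
      relation the two weights are compared by cancellation alone.\<close>
    have eq: "q * (1 - p / (a * q)) * (1 - a / p) = (1 - p / a) * (1 - a * q / p)"
      using q nz by (simp add: field_simps)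
    show ?thesis
      unfolding k_def Phi_weight_def args up(2) R'_def
      unfolding S_def list.map qpochs_inf_simps pprod_simps rprod_simps mult_1_right u
      by (rule weight_up[OF eq]) (fact level_nz up_nz)+
  qed
  \<comment> \<open>\<open>coefB\<close> without its factor 1 - p/q. In the downward companion
    series the symbol of p/q supplies that factor, so the relation persists when p = q.\<close>
  define B1 where "B1 = q * pprod R (1 / q) / ((1 - a / (g * q)) * (1 - a / g))"
  have m_weight: "m * Phi_weight q (a / q\<^sup>2) (p / q) (g # map (\<lambda>r. r / q) R)
      = Phi_weight q a p (g # R) * (B1 * (1 - G) * (1 - p / g) / (1 - p * q / a))"
  proof -
    have args: "a / q\<^sup>2 * q = a / q" "p / q / (a / q\<^sup>2) = p * q / a" "(p / q)\<^sup>2 * q / (a / q\<^sup>2) = p\<^sup>2 * q / a"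
      "a / q\<^sup>2 / (p / q) = a / (p * q)"
      "map (\<lambda>r. p / q * q / r) (g # map (\<lambda>r. r / q) R) = p / g # map (\<lambda>r. p * q / r) R"
      "map (\<lambda>r. a / q / r) (g # map (\<lambda>r. r / q) R) = a / (g * q) # map (\<lambda>r. a / r) R"
      using q by (simp_all add: power2_eq_square)
    have eq: "(1 - a / p) * (1 - p * q / a) = q * (1 - p / a) * (1 - a / (p * q))"
      using q nz by (simp add: field_simps)
    have "1 - G \<noteq> 0"
      using GQ(2) unfolding v by auto
    show ?thesis
      unfolding m_def B1_def Phi_weight_def args down(2) R'_def
      unfolding S_def list.map qpochs_inf_simps rprod_simps v
      by (rule weight_down[OF eq]) (fact level_nz down_nz a1 \<open>1 - G \<noteq> 0\<close>)+
  qed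
  \<comment> \<open>Replacing z by p z/a puts an extra p/a on the right of
    \<open>coef_identity\<close>; the factor a/p compensates it.\<close>
  define l where "l = a / p * (1 - g / q)"
  have q1: "q \<noteq> 1"
    using q by auto
  have S: "length S = 6" "\<forall>p\<in>set S. p \<noteq> 0" "prod_list S * g = a ^ 3 * q\<^sup>2"
    using R nz by (simp_all add: S_def)
  interpret P: contiguous_parameters q a g "g / q" "a / (g * q)"
    using q q1 nz a a1 down_nz up_nz by unfold_locales (auto simp: power2_eq_square)
  have first: "coefA q a g S * k * W10_9 q (a * q\<^sup>2) (g # map (\<lambda>p. p * q) S)
      + m * W10_9 q (a / q\<^sup>2) (g # map (\<lambda>p. p / q) S) + coefC q a g S * W10_9 q a (g # S)
      = (1 - g / q) / (1 - a) * (qpoch_inf q a * qpoch_inf q g * qpochs_inf q S)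
         / (qpoch_inf q q * qpoch_inf q (a * q / g) * qpochs_inf q (map (\<lambda>p. a * q / p) S))"
    unfolding k_def m_def
    by (rule W10_9_shift_relation[OF q nz(1,2) S(2) a W coefB_def coefC_start P.coef_identity(1)])
      (use q(1) q1 a a1 up_nz(1) S in auto)
  have second: "coefA q a g S * (1 - p) * (1 - a' / p) / ((1 - G / q) * (1 - a' * q / G))
           * W10_9 q a' (p * q # G / q # R')
         + B1 * (1 - G) * (1 - a' / G) / (1 - a' * q / p) * W10_9 q a' (p / q # G * q # R')
         + coefC q a g S * W10_9 q a' (p # G # R')
       = l / (1 - a') * (qpoch_inf q a' * qpoch_inf q p * qpoch_inf q G * qpochs_inf q R')
         / (qpoch_inf q q * qpoch_inf q (a' * q / p) * qpoch_inf q (a' * q / G)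
            * qpochs_inf q (map (\<lambda>r. a' * q / r) R'))"
  proof (rule W10_9_transfer_relation[OF q _ nz(3) _ _ _ W'])
    show "a' \<noteq> 0" "G \<noteq> 0" "\<forall>r\<in>set R'. r \<noteq> 0" "G \<noteq> q"
      using nz up_nz(5) q by (auto simp: a'_def G_def R'_def)
    \<comment> \<open>Index 0 of the companion series is z = 1, which becomes the argument p/a of
      \<open>coef_identity\<close>; the cancelled form covers p = q.\<close>
    have "(1 - g / q) / (p / a) * pprod R (p / a) * (1 - g / q * (p / a))
      = coefA q a g (p # R) * (1 - q\<^sup>2 * (g / q) * (a / (g * q)) * (p / a)) * (1 - p / a) * (1 - q * (p / a))
        + q * pprod R (1 / q) / ((1 - a / (g * q)) * (1 - q * (a / (g * q))))
          * (1 - q * (g / q) * (p / a)) * (1 - q * (a / (g * q)) * (p / a)) * (1 - g / q * (p / a)) * (1 - q\<^sup>2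
            * (a / (g * q)) * (p / a))
        + coefC q a g (p # R) * (1 - g / q * (p / a)) * (1 - q\<^sup>2 * (a / (g * q)) * (p / a)) * (1 - q * (p / a))"
      by (rule P.distinguished_identities(1)) (use R nz q in \<open>simp_all add: power2_eq_square\<close>)
    moreover have "(1 - g / q) / (p / a) = l" "g / q * (p / a) = G / q" "q * (g / q) * (p / a) = G"
      "q\<^sup>2 * (g / q) * (a / (g * q)) * (p / a) = p" "q * (p / a) = p * q / a" "q * (a / (g * q)) = a / g"
      "a / g * (p / a) = p / g" "q\<^sup>2 * (a / (g * q)) * (p / a) = p * q / g"
      using q nz by (simp_all add: l_def G_def power2_eq_square mult_ac)
    moreover have "pprod R (p / a) = pprod R' 1"
      by (simp add: R'_def pprod_map_scale)
    ultimately show "l * pprod R' 1 * (1 - G / q) = coefA q a g S * (1 - p) * (1 - a' / p) * (1 - a' * q / p)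
      + B1 * (1 - G) * (1 - a' / G) * (1 - G / q) * (1 - a' * q / G)
      + coefC q a g S * (1 - G / q) * (1 - a' * q / G) * (1 - a' * q / p)"
      unfolding a'_quot S_def B1_def by (simp only:)
  next
    fix z :: complex assume z: "z \<noteq> 0"
    \<comment> \<open>At this argument the letter p of S yields 1 - a' z in \<open>pprod\<close> and
      1 - z in \<open>rprod\<close>, the two factors that accompany the products over R' in the
      transfer relation.\<close>
    define x where "x = p * z / a"
    note identity = P.coef_identity(1)[OF S, of x]
    have quot: "a * x = p * z" "a * x / q = p * z / q" "g * x / q = G * z / q" "g * x = G * z" "q * x = a' * q * z / p"
      "a * q * x / g = a' * q * z / G" "p * z / g = a' * z / G" "a * x\<^sup>2 = a' * z\<^sup>2" "x = a' * z / p"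
      using nz q by (simp_all add: x_def G_def a'_def power2_eq_square)
    have prods: "pprod S x = (1 - a' * z) * pprod R' z" "rprod S (p * z) = (1 - z) * rprod R' (a' * z)"
      using nz by (simp_all add: S_def x_def a'_def R'_def power2_eq_square pprod_map_scale rprod_map_scale)
    have "coefB q a g S = B1 * (1 - p / q)"
      by (simp add: coefB_def B1_def S_def mult_ac)
    note identity' = identity[unfolded quot(1-8) prods this]
    have "l * ((1 - a' * z) * pprod R' z * (1 - p * z / q) * (1 - G * z / q)
           - (1 - z) * rprod R' (a' * z) * (1 - a' * q * z / p) * (1 - a' * q * z / G))
      = a / p * ((1 - g / q) * ((1 - a' * z) * pprod R' z * (1 - p * z / q) * (1 - G * z / q)
           - (1 - z) * rprod R' (a' * z) * (1 - a' * q * z / p) * (1 - a' * q * z / G)))"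
      by (simp add: l_def)
    also have "\<dots> = (1 - a' * z\<^sup>2) * (a / p * x) * (coefA q a g S * (1 - p * z) * (1 - x) * (1 - p * z / q)
      * (1 - a' * q * z / p)
         + B1 * (1 - p / q) * (1 - G * z) * (1 - a' * z / G) * (1 - G * z / q) * (1 - a' * q * z / G)
         + coefC q a g S * (1 - G * z / q) * (1 - a' * q * z / G) * (1 - p * z / q) * (1 - a' * q * z / p))"
      unfolding identity' by (simp only: mult_ac)
    also have "a / p * x = z"
      using nz by (simp add: x_def)
    finally show "l * ((1 - a' * z) * pprod R' z * (1 - p * z / q) * (1 - G * z / q)
           - (1 - z) * rprod R' (a' * z) * (1 - a' * q * z / p) * (1 - a' * q * z / G))
      = (1 - a' * z\<^sup>2) * z *
        (coefA q a g S * (1 - p * z) * (1 - a' * z / p) * (1 - p * z / q) * (1 - a' * q * z / p)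
         + B1 * (1 - p / q) * (1 - G * z) * (1 - a' * z / G) * (1 - G * z / q) * (1 - a' * q * z / G)
         + coefC q a g S * (1 - p * z / q) * (1 - a' * q * z / p) * (1 - G * z / q) * (1 - a' * q * z / G))"
      unfolding quot(9) by (simp only: mult_ac)
  qed
  have boundary: "(1 - g / q) / (1 - a) * (qpoch_inf q a * qpoch_inf q g * qpochs_inf q S)
         / (qpoch_inf q q * qpoch_inf q (a * q / g) * qpochs_inf q (map (\<lambda>p. a * q / p) S))
       + Phi_weight q a p (g # R) * (l / (1 - a') * (qpoch_inf q a' * qpoch_inf q p * qpoch_inf q G * qpochs_inf q R')
         / (qpoch_inf q q * qpoch_inf q (a' * q / p) * qpoch_inf q (a' * q / G)
            * qpochs_inf q (map (\<lambda>r. a' * q / r) R'))) = 0"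
  proof -
    have a_unf: "qpoch_inf q a = (1 - a) * qpoch_inf q (a * q)" "qpoch_inf q a' = (1 - a') * qpoch_inf q (p\<^sup>2 * q / a)"
      using U[of a] U[of a'] by (simp_all add: a'_def)
    \<comment> \<open>The minus sign that makes the two infinite products cancel.\<close>
    have eq: "a / p * (1 - p / a) = - (1 - a / p)"
      using nz by (simp add: field_simps)
    show ?thesis
      unfolding a_unf a'_quot l_def Phi_weight_def
      unfolding S_def list.map qpochs_inf_simps u(3) v(2) R'_def G_def
      by (rule weight_boundary[OF eq]) (fact a1 nonzero(1) level_nz nonzero(3,6) W'')+
  qed
  have Phi_up: "Phi_dist q (a * q\<^sup>2) (p * q) (g # map (\<lambda>r. r * q) R)
      = W10_9 q (a * q\<^sup>2) (g # map (\<lambda>p. p * q) S)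
        + Phi_weight q (a * q\<^sup>2) (p * q) (g # map (\<lambda>r. r * q) R) * W10_9 q a' (p * q # G / q # R')"
    and Phi_down: "Phi_dist q (a / q\<^sup>2) (p / q) (g # map (\<lambda>r. r / q) R)
      = W10_9 q (a / q\<^sup>2) (g # map (\<lambda>p. p / q) S)
        + Phi_weight q (a / q\<^sup>2) (p / q) (g # map (\<lambda>r. r / q) R) * W10_9 q a' (p / q # G * q # R')"
    and Phi_level: "Phi_dist q a p (g # R) = W10_9 q a (g # S) + Phi_weight q a p (g # R) * W10_9 q a' (p # G # R')"
    unfolding Phi_dist_def up down by (simp_all add: W10_9_swap S_def a'_def G_def R'_def)
  show ?thesis
    unfolding k_def[symmetric] m_def[symmetric] Phi_up Phi_down Phi_level
    by (rule combine_series[OF first second[unfolded a'_quot] boundary[unfolded a'_quot] k_weight m_weight])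
qed

section \<open>The unshifted letter g is distinguished\<close>

lemma combine_series_special:
  fixes A :: complex
  assumes "A * k * Wp + m * Wm + C * W = L"
    and "B * c * k' * Vm + r * Vp + C * c * V = L'" and "L + M * (L' / c) = 0"
    and "A * k * Mp = M * (r / c)" and "m * Mm = M * (B * k')" and "c \<noteq> 0"
  shows "A * k * (Wp + Mp * Vp) + m * (Wm + Mm * Vm) + C * (W + M * V) = 0"
proof -
  have "A * k * (Wp + Mp * Vp) + m * (Wm + Mm * Vm) + C * (W + M * V)
    = (A * k * Wp + m * Wm + C * W) + ((A * k * Mp) * Vp + (m * Mm) * Vm + M * (C * V))"
    by (simp add: algebra_simps)
  also have "\<dots> = L + M * (L' / c)"
    unfolding assms(1,4,5) assms(2)[symmetric] using assms(6) by (simp add: field_simps)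
  finally show ?thesis
    using assms(3) by simp
qed

lemma weight_up_special:
  fixes q n1 :: complex
  assumes "v * q * x1 * x2 * c = g1 * g2" and "g1 \<noteq> 0" "g2 \<noteq> 0" "PT \<noteq> 0" "RS \<noteq> 0" "c \<noteq> 0"
  shows "v * PT / (z1 * g1) * (q * n1 * n2 * PS / (g1 * g2 * RS))
      * (Aq3 * (x1 * (x2 * Pg)) / (y2 * (y1 * X) * Y) * (Sq * (Rg * Z) / (U * (PT * T))))
    = n1 * (n2 * Aq3) * Pg / (X * (z1 * (g1 * Y))) * (PS * Sq * Z / (RS * U * T)) * (Rg / (y1 * y2) / c)"
proof -
  have "v * q * x1 * x2 / (g1 * g2) = 1 / c"
    using assms by (simp add: field_simps)
  moreover have "v * PT / (z1 * g1) * (q * n1 * n2 * PS / (g1 * g2 * RS))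
      * (Aq3 * (x1 * (x2 * Pg)) / (y2 * (y1 * X) * Y) * (Sq * (Rg * Z) / (U * (PT * T))))
    = v * q * x1 * x2 / (g1 * g2) * (n1 * (n2 * Aq3) * Pg / (X * (z1 * (g1 * Y))) * (PS * Sq * Z / (RS * U * T)) * (Rg / (y1 * y2)))"
    using assms(4) by (simp add: mult_ac)
  ultimately show ?thesis
    by simp
qed

lemma weight_down_special:
  fixes q n1 :: complex
  assumes "z1 * k2 = q * q * p1 * x1"
    and "n1 \<noteq> 0"
    "n2 \<noteq> 0"
    "RS \<noteq> 0"
    "p2 \<noteq> 0"
    "y1 \<noteq> 0"
    "y2 \<noteq> 0"
    "G \<noteq> 0"
    "PT \<noteq> 0" "z1 \<noteq> 0" "k2 \<noteq> 0"
  shows "RS / (n1 * n2) * (n2 * (n1 * Aq) * Pq / (Xq * (x1 * (h1 * Y))) * (PS * R * Z / (RS * U * T)))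
    = Aq * (p1 * (p2 * Pq)) / (y1 * (y2 * Xq) * Y) * (R * (G * Z) / (U * (PT * T)))
      * (q * PS / (h1 * z1) * (q * y1 * y2 * PT / (p2 * k2 * G)))"
proof -
  have "q * q * p1 / (z1 * k2) = 1 / x1"
    unfolding assms(1) using assms by auto
  moreover have "Aq * (p1 * (p2 * Pq)) / (y1 * (y2 * Xq) * Y) * (R * (G * Z) / (U * (PT * T)))
      * (q * PS / (h1 * z1) * (q * y1 * y2 * PT / (p2 * k2 * G)))
    = q * q * p1 / (z1 * k2) * (Aq * Pq / (Xq * Y) * (R * Z / (U * T)) * PS / h1)"
    using assms(2-9) by (simp add: mult_ac)
  ultimately show ?thesis
    using assms(2-4) by (simp add: mult_ac)
qed

lemma weight_boundary_special:
  fixes l n1 :: complex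
  assumes "p0 / c = - z1" and "n1 \<noteq> 0" "n2 \<noteq> 0" "X \<noteq> 0" "z1 \<noteq> 0" "T \<noteq> 0" "Z \<noteq> 0" "Pq \<noteq> 0"
  shows "l / n1 * (n1 * Aq * g * S) / (Q * Ag * U)
     + Aq * (p0 * Pq) / (X * (z1 * Ag)) * (S * Z / (U * T)) * (l / n2 * (n2 * X * g * T) / (Q * Pq * Z) / c) = 0"
proof -
  have "Aq * (p0 * Pq) / (X * (z1 * Ag)) * (S * Z / (U * T)) * (l / n2 * (n2 * X * g * T) / (Q * Pq * Z) / c)
    = p0 / c / z1 * (l * Aq * g * S / (Q * Ag * U))"
    using assms(2-) by (simp add: mult_ac)
  then show ?thesis
    unfolding assms(1) using assms(2,5) by (simp add: mult_ac)
qed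

lemma scaled_fraction:
  fixes v :: complex
  assumes "v * w * c / y = s / t"
  shows "v * (w * x) / y * c = s * x / t"
proof -
  have "v * (w * x) / y * c = v * w * c / y * x"
    by simp
  then show ?thesis
    unfolding assms by simp
qed

text \<open>The companion series obey the same shift relation, with g/a times \<open>coefB\<close>,
  \<open>coefA\<close> and \<open>coefC\<close> in the places of \<open>A\<close>, \<open>B\<close>
  and \<open>C\<close>. That g/a times \<open>coefA\<close> has the form required of
  \<open>B\<close> rests on the balancing condition.\<close>

lemma contiguous_special_letter:
  fixes q a g :: complex and S :: "complex list"
  assumes q: "q \<noteq> 0" "norm q < 1"
    and nz: "a \<noteq> 0" "g \<noteq> 0" "\<forall>r\<in>set S. r \<noteq> 0" and a: "a \<noteq> q"
    and S: "length S = 6" "prod_list S * g = a^3 * q\<^sup>2"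
    and ns0: "Phi_dist_nonsingular q a g S"
    and nsp: "Phi_dist_nonsingular q (a * q\<^sup>2) g (map (\<lambda>r. r * q) S)"
    and nsm: "Phi_dist_nonsingular q (a / q\<^sup>2) g (map (\<lambda>r. r / q) S)"
  shows "coefA q a g S * (q * (1 - a * q) * (1 - a * q\<^sup>2) * pprod S 1
              / ((1 - a * q / g) * (1 - a * q\<^sup>2 / g) * rprod S (a * q)))
           * Phi_dist q (a * q\<^sup>2) g (map (\<lambda>r. r * q) S)
       + rprod S a / ((1 - a) * (1 - a / q)) * Phi_dist q (a / q\<^sup>2) g (map (\<lambda>r. r / q) S)
       + coefC q a g S * Phi_dist q a g S = 0"
proof -
  define k where "k = q * (1 - a * q) * (1 - a * q\<^sup>2) * pprod S 1
              / ((1 - a * q / g) * (1 - a * q\<^sup>2 / g) * rprod S (a * q))"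
  define m where "m = rprod S a / ((1 - a) * (1 - a / q))"
  define S' where "S' = map (\<lambda>r. g * r / a) S"
  define a' where "a' = g\<^sup>2 / a"
  define k' where "k' = q * (1 - a' * q) * (1 - a' * q\<^sup>2) * pprod S' 1
              / ((1 - a' * q / g) * (1 - a' * q\<^sup>2 / g) * rprod S' (a' * q))"
  define r where "r = rprod S' a' / ((1 - a') * (1 - a' / q))"
  have up: "g\<^sup>2 / (a * q\<^sup>2) = a' / q\<^sup>2"
    "map (\<lambda>r. g * r / (a * q\<^sup>2)) (map (\<lambda>r. r * q) S) = map (\<lambda>r. r / q) S'"
    using q by (simp_all add: a'_def S'_def power2_eq_square)
  have down: "g\<^sup>2 / (a / q\<^sup>2) = a' * q\<^sup>2"
    "map (\<lambda>r. g * r / (a / q\<^sup>2)) (map (\<lambda>r. r / q) S) = map (\<lambda>r. r * q) S'"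
    using q by (simp_all add: a'_def S'_def power2_eq_square)
  have a'_quot: "a' / g = g / a" "a' * q / g = g * q / a" "a' * q\<^sup>2 / g = g * q\<^sup>2 / a"
    "map (\<lambda>r. a' * q / r) S' = map (\<lambda>r. g * q / r) S"
    using q nz by (simp_all add: a'_def S'_def power2_eq_square)
  have prods: "pprod S' 1 = pprod S (g / a)" "rprod S' a' = rprod S g" "rprod S' (a' * q) = rprod S (g * q)"
    using nz by (simp_all add: a'_def S'_def pprod_map_scale rprod_map_scale power2_eq_square)
  have nonzero: "qpoch_inf q (g\<^sup>2 * q / a) \<noteq> 0" "qpoch_inf q (a / g) \<noteq> 0"
    "qpochs_inf q (map (\<lambda>r. a * q / r) S) \<noteq> 0" "qpochs_inf q (map (\<lambda>r. g * r / a) S) \<noteq> 0"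
    using ns0 by (simp_all add: Phi_dist_nonsingular_def)
  have nonzero_up: "qpoch_inf q (a' / q) \<noteq> 0" "qpochs_inf q (map (\<lambda>r. g * r / (a * q)) S) \<noteq> 0"
    using nsp q unfolding Phi_dist_nonsingular_def
    by (simp_all add: a'_def power2_eq_square o_def)
  have nonzero_down: "qpoch_inf q (a / (g * q * q)) \<noteq> 0" "qpochs_inf q (map (\<lambda>r. a / r) S) \<noteq> 0"
    using nsm q unfolding Phi_dist_nonsingular_def
    by (simp_all add: power2_eq_square o_def mult_ac)
  have W: "W10_9_nonsingular q a (g # S)"
    "W10_9_nonsingular q (a * q\<^sup>2) (g # map (\<lambda>p. p * q) S)"
    "W10_9_nonsingular q (a / q\<^sup>2) (g # map (\<lambda>p. p / q) S)"
    and W': "W10_9_nonsingular q a' (g # S')"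
    "W10_9_nonsingular q (a' * q\<^sup>2) (g # map (\<lambda>p. p * q) S')"
    "W10_9_nonsingular q (a' / q\<^sup>2) (g # map (\<lambda>p. p / q) S')"
    using ns0 nsp nsm unfolding Phi_dist_nonsingular_def up down
    by (simp_all add: a'_def S'_def)
  have W'': "qpoch_inf q (g * q / a) \<noteq> 0" "qpochs_inf q (map (\<lambda>r. g * q / r) S) \<noteq> 0"
    "qpoch_inf q q \<noteq> 0" "qpoch_inf q (a * q / g) \<noteq> 0"
    using W10_9_nonsingular_inf[OF q(2) W'(1)] W10_9_nonsingular_inf[OF q(2) W(1)] unfolding list.map a'_quot
    by (simp_all)
  have U: "qpoch_inf q x = (1 - x) * qpoch_inf q (x * q)" for x
    by (rule qpoch_inf_unfold[OF q(2)])
  then have U2: "qpoch_inf q x = (1 - x) * ((1 - x * q) * qpoch_inf q (x * q * q))" for x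
    by metis
  have V: "qpochs_inf q xs = pprod xs 1 * qpochs_inf q (map (\<lambda>x. x * q) xs)" for xs
    by (rule qpochs_inf_unfold[OF q(2)])
  have u: "qpoch_inf q (a * q) = (1 - a * q) * ((1 - a * q\<^sup>2) * qpoch_inf q (a * q * q * q))"
    "qpoch_inf q (g / (a * q\<^sup>2)) = (1 - g / (a * q\<^sup>2)) * ((1 - g / (a * q)) * qpoch_inf q (g / a))"
    "qpoch_inf q (a' / q) = (1 - a' / q) * ((1 - a') * qpoch_inf q (g\<^sup>2 * q / a))"
    "qpoch_inf q (a / g) = (1 - a / g) * ((1 - a * q / g) * qpoch_inf q (a * q\<^sup>2 / g))"
    "qpochs_inf q S = pprod S 1 * qpochs_inf q (map (\<lambda>r. r * q) S)"
    "qpochs_inf q (map (\<lambda>r. g / r) S) = rprod S g * qpochs_inf q (map (\<lambda>r. g * q / r) S)"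
    "qpochs_inf q (map (\<lambda>r. a * q / r) S) = rprod S (a * q) * qpochs_inf q (map (\<lambda>r. a * q / r * q) S)"
    "qpochs_inf q (map (\<lambda>r. g * r / (a * q)) S) = pprod S (g / (a * q)) * qpochs_inf q (map (\<lambda>r. g * r / a) S)"
    using U2[of "a * q"] U2[of "g / (a * q\<^sup>2)"] U2[of "a' / q"] U2[of "a / g"] V[of S] V[of "map (\<lambda>r. g / r) S"]
      V[of "map (\<lambda>r. a * q / r) S"] V[of "map (\<lambda>r. g * r / (a * q)) S"] q
    by (simp_all add: pprod_map_div pprod_map_scale power2_eq_square mult.assoc o_def a'_def)
  have v: "qpoch_inf q (a / q) = (1 - a / q) * ((1 - a) * qpoch_inf q (a * q))"
    "qpoch_inf q (g / a) = (1 - g / a) * ((1 - g * q / a) * qpoch_inf q (g * q * q / a))"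
    "qpoch_inf q (g\<^sup>2 * q / a) = (1 - a' * q) * ((1 - a' * q\<^sup>2) * qpoch_inf q (a' * q * q * q))"
    "qpoch_inf q (a / (g * q * q)) = (1 - a / (g * q * q)) * ((1 - a / (g * q)) * qpoch_inf q (a / g))"
    "qpochs_inf q (map (\<lambda>r. r / q) S) = pprod S (1 / q) * qpochs_inf q S"
    "qpochs_inf q (map (\<lambda>r. g * q / r) S) = rprod S (g * q) * qpochs_inf q (map (\<lambda>r. g * q * q / r) S)"
    "qpochs_inf q (map (\<lambda>r. a / r) S) = rprod S a * qpochs_inf q (map (\<lambda>r. a * q / r) S)"
    "qpochs_inf q (map (\<lambda>r. g * r / a) S) = pprod S (g / a) * qpochs_inf q (map (\<lambda>r. g * r * q / a) S)"
    using U2[of "a / q"] U2[of "g / a"] U2[of "a' * q"] U2[of "a / (g * q * q)"] V[of "map (\<lambda>r. r / q) S"]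
      V[of "map (\<lambda>r. g * q / r) S"] V[of "map (\<lambda>r. a / r) S"] V[of "map (\<lambda>r. g * r / a) S"] q
    by (simp_all add: pprod_map_div pprod_map_divide pprod_map_scale power2_eq_square mult.assoc o_def a'_def)
  have up_nz: "1 - a' / q \<noteq> 0" "1 - a' \<noteq> 0" "1 - a / g \<noteq> 0" "1 - a * q / g \<noteq> 0"
    "rprod S (a * q) \<noteq> 0" "pprod S (g / (a * q)) \<noteq> 0" "qpoch_inf q (a * q\<^sup>2 / g) \<noteq> 0"
    using nonzero_up nonzero(2,3) unfolding u by auto
  have "1 - a * q\<^sup>2 / g \<noteq> 0"
    using up_nz(7) U[of "a * q\<^sup>2 / g"] by auto
  note up_nz = this up_nz
  have down_nz: "1 - a / (g * q) \<noteq> 0"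
    "1 - a' * q \<noteq> 0"
    "1 - a' * q\<^sup>2 \<noteq> 0"
    "rprod S (g * q) \<noteq> 0"
    "rprod S a \<noteq> 0"
    "pprod S (g / a) \<noteq> 0" "1 - g * q / a \<noteq> 0" "1 - g * q\<^sup>2 / a \<noteq> 0"
    using nonzero_down nonzero(1,4) W''(1,2) U2[of "g * q / a"] unfolding v
    by (auto simp: power2_eq_square mult.assoc)
  have a1: "1 - a \<noteq> 0" "1 - a / q \<noteq> 0"
    using W10_9_nonsingularD(1)[OF W(1)] a q by auto
  have c: "g / a \<noteq> 0"
    using nz by simp
  \<comment> \<open>\<open>coefA\<close> contains inverted letters; in this form the product is that
    of the companion letters g r/a at 1/q.\<close>
  have rprod_inv: "rprod S (a * q / g) = a^3 * q^4 / g^5 * pprod S (g / (a * q))"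
  proof -
    have "prod_list S = a^3 * q\<^sup>2 / g"
      using S(2) nz by (simp add: eq_divide_eq)
    then have "a^3 * q\<^sup>2 / g * rprod S (a * q / g) = (a * q / g)^6 * pprod S (g / (a * q))"
      using rprod_inverse[OF nz(3), of "a * q / g"] S(1) q nz by simp
    then show ?thesis
      using q nz by (simp add: field_simps power_numeral_reduce)
  qed
  have k_weight: "coefA q a g S * k * Phi_weight q (a * q\<^sup>2) g (map (\<lambda>r. r * q) S)
      = Phi_weight q a g S * (r / (g / a))"
  proof -
    have args: "a * q\<^sup>2 * q = a * q * q * q" "g\<^sup>2 * q / (a * q\<^sup>2) = a' / q"
      "map (\<lambda>r. g * q / r) (map (\<lambda>r. r * q) S) = map (\<lambda>r. g / r) S"
      "map (\<lambda>r. a * q * q * q / r) (map (\<lambda>r. r * q) S) = map (\<lambda>r. a * q / r * q) S"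
      "map (\<lambda>r. g * r / (a * q\<^sup>2)) (map (\<lambda>r. r * q) S) = map (\<lambda>r. g * r / (a * q)) S"
      using q by (simp_all add: power2_eq_square a'_def)
    have eq: "(g / q)\<^sup>2 * (a^3 * q^4 / g^5) * q * (1 - g / (a * q\<^sup>2)) * (1 - g / (a * q)) * (g / a)
        = (1 - a * q / g) * (1 - a * q\<^sup>2 / g)"
      using q nz by (simp add: field_simps power_numeral_reduce)
    have A: "coefA q a g S = (g / q)\<^sup>2 * (a^3 * q^4 / g^5) * pprod S (g / (a * q)) / ((1 - a / g) * (1 - a * q / g))"
      by (simp add: coefA_def rprod_inv)
    show ?thesis
      unfolding k_def r_def prods A Phi_weight_def args
      unfolding u
      by (rule weight_up_special[OF eq]) (fact up_nz c)+
  qed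
  have m_weight: "m * Phi_weight q (a / q\<^sup>2) g (map (\<lambda>r. r / q) S)
      = Phi_weight q a g S * (coefB q a g S * k')"
  proof -
    have args: "a / q\<^sup>2 * q = a / q" "g / (a / q\<^sup>2) = g * q * q / a" "g\<^sup>2 * q / (a / q\<^sup>2) = a' * q * q * q"
      "a / q\<^sup>2 / g = a / (g * q * q)"
      "map (\<lambda>r. g * q / r) (map (\<lambda>r. r / q) S) = map (\<lambda>r. g * q * q / r) S"
      "map (\<lambda>r. a / q / r) (map (\<lambda>r. r / q) S) = map (\<lambda>r. a / r) S"
      "map (\<lambda>r. g * r / (a / q\<^sup>2)) (map (\<lambda>r. r / q) S) = map (\<lambda>r. g * r * q / a) S"
      using q by (simp_all add: power2_eq_square a'_def)
    have eq: "(1 - a / g) * (1 - g * q\<^sup>2 / a) = q * q * (1 - g / a) * (1 - a / (g * q * q))"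
      using q nz by (simp add: field_simps power2_eq_square)
    show ?thesis
      unfolding m_def k'_def prods a'_quot coefB_def Phi_weight_def args
      unfolding v
      by (rule weight_down_special[OF eq]) (fact up_nz down_nz a1)+
  qed
  have q1: "q \<noteq> 1"
    using q by auto
  interpret P: contiguous_parameters q a g "g / q" "a / (g * q)"
    using q q1 nz a a1 down_nz up_nz by unfold_locales (auto simp: power2_eq_square)
  note S' = S(1) nz(3) S(2)
  have first: "coefA q a g S * k * W10_9 q (a * q\<^sup>2) (g # map (\<lambda>p. p * q) S)
      + m * W10_9 q (a / q\<^sup>2) (g # map (\<lambda>p. p / q) S) + coefC q a g S * W10_9 q a (g # S)
      = (1 - g / q) / (1 - a) * (qpoch_inf q a * qpoch_inf q g * qpochs_inf q S)
         / (qpoch_inf q q * qpoch_inf q (a * q / g) * qpochs_inf q (map (\<lambda>p. a * q / p) S))"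
    unfolding k_def m_def
    by (rule W10_9_shift_relation[OF q nz a W coefB_def coefC_start P.coef_identity(1)])
      (use q(1) q1 a a1 up_nz(5) S' in auto)
  have second: "coefB q a g S * (g / a) * k' * W10_9 q (a' * q\<^sup>2) (g # map (\<lambda>p. p * q) S')
      + r * W10_9 q (a' / q\<^sup>2) (g # map (\<lambda>p. p / q) S') + coefC q a g S * (g / a) * W10_9 q a' (g # S')
      = (1 - g / q) / (1 - a') * (qpoch_inf q a' * qpoch_inf q g * qpochs_inf q S')
         / (qpoch_inf q q * qpoch_inf q (a' * q / g) * qpochs_inf q (map (\<lambda>p. a' * q / p) S'))"
    unfolding k'_def r_def
  proof (rule W10_9_shift_relation[OF q _ nz(2) _ _ W'])
    show "a' \<noteq> 0" "a' \<noteq> q" "\<forall>p\<in>set S'. p \<noteq> 0"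
      using nz up_nz(2) q by (auto simp: a'_def S'_def)
    have eq: "(g / q)\<^sup>2 * (a^3 * q^4 / g^5) * (g / a) * ((1 - g / (a * q)) * (1 - g / a))
        = q * ((1 - a / g) * (1 - a * q / g))"
      using q nz by (simp add: field_simps power_numeral_reduce)
    show "coefA q a g S * (g / a) = q * pprod S' (1 / q) / ((1 - a' / (g * q)) * (1 - a' / g))"
    proof -
      have "1 - g / (a * q) \<noteq> 0" "1 - g / a \<noteq> 0"
        using up_nz(4,5) q nz by auto
      from \<open>1 - g / (a * q) \<noteq> 0\<close> \<open>1 - g / a \<noteq> 0\<close> have "(g / q)\<^sup>2 * (a^3
        * q^4 / g^5) * (g / a) / ((1 - a / g) * (1 - a * q / g))
          = q / ((1 - g / (a * q)) * (1 - g / a))"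
        using up_nz(4,5) by (intro iffD2[OF frac_eq_eq eq]) simp_all
      moreover have "a' / (g * q) = g / (a * q)"
        using nz by (simp add: a'_def power2_eq_square)
      moreover have "pprod S' (1 / q) = pprod S (g / (a * q))"
        unfolding S'_def pprod_map_scale by (simp add: mult.commute)
      ultimately show ?thesis
        unfolding coefA_def rprod_inv a'_quot by (simp only: scaled_fraction)
    qed
  next
    show "pprod S' 1 * (1 - a' / q) * (1 - g / q) - rprod S' a' * (1 - q) * (1 - a' * q / g)
      = (1 - a') * (1 - a' * q / g)
        * (coefA q a g S * (g / a) * (1 - g) * (1 - a' / g) + coefC q a g S * (g / a) * (1 - a' / q) * (1 - q))"
    proof -
      have "g / q / (q * (a / (g * q))) = a' / q" "1 / (a / (g * q)) = g * q / a" "g / q / (a / (g * q)) = a'"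
        using q nz by (simp_all add: a'_def power2_eq_square)
      then show ?thesis
        using P.coef_identity(2)[OF S'] unfolding prods a'_quot by simp
    qed
  next
    fix z :: complex assume z: "z \<noteq> 0"
    \<comment> \<open>The substitution exchanges the quartics that accompany \<open>coefA\<close>
      and \<open>coefB\<close> and reproduces that of \<open>coefC\<close>, with a' in place of
      a.\<close>
    define x where "x = g * z / a"
    have quot: "a * x = g * z" "g * z / g = z" "g * x / q = a' * z / q" "g * x = a' * z" "q * x = a' * q * z / g"
      "a * q * x / g = q * z" "a * x\<^sup>2 = a' * z\<^sup>2" "x = a' * z / g"
      using nz q by (simp_all add: x_def a'_def power2_eq_square)
    have prods: "pprod S x = pprod S' z" "rprod S (g * z) = rprod S' (a' * z)"
      using nz by (simp_all add: x_def a'_def S'_def power2_eq_square pprod_map_scale rprod_map_scale)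
    note identity = P.coef_identity(1)[OF S', of x, unfolded quot(1-7) prods]
    have "(1 - g / q) * (pprod S' z * (1 - a' * z / q) * (1 - g * z / q)
           - rprod S' (a' * z) * (1 - q * z) * (1 - a' * q * z / g))
      = (1 - a' * z\<^sup>2) * x *
        (coefB q a g S * (1 - a' * z) * (1 - z) * (1 - a' * z / q) * (1 - q * z)
         + coefA q a g S * (1 - g * z) * (1 - x) * (1 - g * z / q) * (1 - a' * q * z / g)
         + coefC q a g S * (1 - g * z / q) * (1 - a' * q * z / g) * (1 - a' * z / q) * (1 - q * z))"
      using identity by (simp only: ac_simps)
    also have "(1 - a' * z\<^sup>2) * x = (1 - a' * z\<^sup>2) * z * (g / a)"
      by (simp add: x_def)
    finally show "(1 - g / q) * (pprod S' z * (1 - a' * z / q) * (1 - g * z / q)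
           - rprod S' (a' * z) * (1 - q * z) * (1 - a' * q * z / g))
      = (1 - a' * z\<^sup>2) * z *
        (coefB q a g S * (g / a) * (1 - a' * z) * (1 - z) * (1 - a' * z / q) * (1 - q * z)
         + coefA q a g S * (g / a) * (1 - g * z) * (1 - a' * z / g) * (1 - g * z / q) * (1 - a' * q * z / g)
         + coefC q a g S * (g / a) * (1 - g * z / q) * (1 - a' * q * z / g) * (1 - a' * z / q) * (1 - q * z))"
      unfolding quot(8) by (simp only: distrib_left ac_simps)
  qed
  have boundary: "(1 - g / q) / (1 - a) * (qpoch_inf q a * qpoch_inf q g * qpochs_inf q S)
         / (qpoch_inf q q * qpoch_inf q (a * q / g) * qpochs_inf q (map (\<lambda>p. a * q / p) S))
      + Phi_weight q a g S * ((1 - g / q) / (1 - a') * (qpoch_inf q a' * qpoch_inf q g * qpochs_inf q S')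
         / (qpoch_inf q q * qpoch_inf q (a' * q / g) * qpochs_inf q (map (\<lambda>p. a' * q / p) S')) / (g / a)) = 0"
  proof -
    have a_unf: "qpoch_inf q a = (1 - a) * qpoch_inf q (a * q)" "qpoch_inf q a' = (1 - a') * qpoch_inf q (g\<^sup>2 * q / a)"
      "qpoch_inf q (g / a) = (1 - g / a) * qpoch_inf q (g * q / a)"
      "qpoch_inf q (a / g) = (1 - a / g) * qpoch_inf q (a * q / g)"
      using U[of a] U[of a'] U[of "g / a"] U[of "a / g"] by (simp_all add: a'_def)
    have eq: "(1 - g / a) / (g / a) = - (1 - a / g)"
      using nz by (simp add: field_simps)
    show ?thesis
      unfolding a'_quot a_unf Phi_weight_def unfolding S'_def
      by (rule weight_boundary_special[OF eq]) (fact a1 up_nz nonzero W'')+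
  qed
  have Phi_up: "Phi_dist q (a * q\<^sup>2) g (map (\<lambda>r. r * q) S)
      = W10_9 q (a * q\<^sup>2) (g # map (\<lambda>p. p * q) S)
        + Phi_weight q (a * q\<^sup>2) g (map (\<lambda>r. r * q) S) * W10_9 q (a' / q\<^sup>2) (g # map (\<lambda>p. p / q) S')"
    and Phi_down: "Phi_dist q (a / q\<^sup>2) g (map (\<lambda>r. r / q) S)
      = W10_9 q (a / q\<^sup>2) (g # map (\<lambda>p. p / q) S)
        + Phi_weight q (a / q\<^sup>2) g (map (\<lambda>r. r / q) S) * W10_9 q (a' * q\<^sup>2) (g # map (\<lambda>p. p * q) S')"
    and Phi_level: "Phi_dist q a g S = W10_9 q a (g # S) + Phi_weight q a g S * W10_9 q a' (g # S')"
    unfolding Phi_dist_def up down by (simp_all add: a'_def S'_def)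
  show ?thesis
    unfolding k_def[symmetric] m_def[symmetric] Phi_up Phi_down Phi_level
    by (rule combine_series_special[OF first second boundary k_weight m_weight c])
qed

section \<open>The contiguous relation in all positions\<close>

text \<open>Both series and all products are symmetric in the letters that are not distinguished, so
  any arrangement R of them serves; a product over a list is non-zero iff each of its factors
  is.\<close>

lemma Phi_eq_Phi_dist:
  assumes "i < length ps" "\<forall>r\<in>set ps. r \<noteq> 0" "mset R = mset (others ps i)" "p = ps ! i"
  shows "Phi q i a ps = Phi_dist q a p R"
    and "Phi_nonsingular q i a ps \<longleftrightarrow> Phi_dist_nonsingular q a p R"
proof -
  have ps: "mset ps = mset (p # R)"
    using assms(1,3,4) by (subst id_take_nth_drop[OF assms(1)]) (simp add: others_def)
  have set_R: "set R = set (others ps i)"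
    using assms(3) by (rule mset_eq_setD)
  have R: "mset (map f R) = mset (map f (others ps i))" for f :: "complex \<Rightarrow> complex"
    using assms(3) by simp
  have prods: "(\<Prod>r\<leftarrow>others ps i. f r) = (\<Prod>r\<leftarrow>R. f r)" for f :: "complex \<Rightarrow> complex"
    using R[of f] by (metis prod_mset_prod_list)
  have quot: "(\<Prod>r\<leftarrow>R. (f1 r * f2 r) / (f3 r * f4 r))
      = prod_list (map f1 R) * prod_list (map f2 R) / (prod_list (map f3 R) * prod_list (map f4 R))"
    for f1 f2 f3 f4 :: "complex \<Rightarrow> complex"
    by (induction R) (auto simp: mult_ac)
  have W: "W10_9 q x (p # map f (others ps i)) = W10_9 q x (p # map f R)"
    "W10_9_nonsingular q x (p # map f (others ps i)) = W10_9_nonsingular q x (p # map f R)"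
    for x and f :: "complex \<Rightarrow> complex"
    using assms(3) by (auto intro!: W10_9_mset)
  show "Phi q i a ps = Phi_dist q a p R"
    unfolding Phi_def Phi_dist_def Phi_weight_def Let_def assms(4)[symmetric] W W10_9_mset(1)[OF ps] prods quot
      qpochs_inf_def by (simp add: o_def)
  show "Phi_nonsingular q i a ps \<longleftrightarrow> Phi_dist_nonsingular q a p R"
    unfolding Phi_nonsingular_def Phi_dist_nonsingular_def Let_def assms(4)[symmetric] W W10_9_mset(2)[OF ps]
      set_R[symmetric] qpochs_inf_def by (auto simp: prod_list_zero_iff)
qed

lemma prods_mset:
  assumes "mset S = mset S'"
  shows "pprod S x = pprod S' x" "rprod S x = rprod S' x"
  using assms unfolding pprod_def rprod_def prod_mset_prod_list[symmetric] mset_map by simp_all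

lemma coef_mset:
  assumes "mset S = mset S'"
  shows "coefA q a g S = coefA q a g S'" "coefC q a g S = coefC q a g S'"
  unfolding coefA_def coefB_def coefC_def prods_mset[OF assms] by simp_all

text \<open>Identifies the bracket of the theorem, which singles out h, with a multiple of the
  symmetric \<open>coefC\<close>. The poles of its last two summands at h = g q cancel, as the right
  side has none there.\<close>

lemma coefC_statement:
  assumes q: "q \<noteq> 0" "q \<noteq> 1" and a: "a \<noteq> 0" "a \<noteq> 1" "a \<noteq> q"
    and g: "g \<noteq> 0" "1 - a / (g * q) \<noteq> 0" "1 - a / g \<noteq> 0" "1 - a * q / g \<noteq> 0"
    and R: "length R = 5" "\<forall>p\<in>set R. p \<noteq> 0" "h * prod_list R * g = a^3 * q\<^sup>2"
    and h: "1 - g * q / h \<noteq> 0"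
  shows "a * q / h * (1 - h / g) * (1 - g * h / (a * q)) * pprod R 1
        + g\<^sup>2 * q\<^sup>2 / h
          * (((1 - a * q / g) * (1 - a / h) * (1 - a * q / h) * (1 - h / q) * rprod R (a / g))
             / ((1 - g * q / h) * (1 - a / (g * q))))
        - (h * (1 - g) * (1 - a / g) * (1 - a * q / g) * rprod R (a * q / h)) / (1 - g * q / h)
     = q * (1 - a * q / h) * (1 - a / g) * (1 - a * q / g) * coefC q a g (h # R)"
proof -
  define y t w where "y = g / q" and "t = a / (g * q)" and "w = h / a"
  have h0: "h \<noteq> 0"
    using R q a by auto
  interpret P: contiguous_parameters q a g y t
    using assms by unfold_locales (auto simp: y_def t_def power2_eq_square)
  note defs = y_def t_def w_def
  have eqs: "q / w = a * q / h" "q * t * w = h / g" "y * w = g * h / (a * q)" "q\<^sup>2 * y / (t * w) = g\<^sup>2 * q\<^sup>2 / h"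
    "1 / w = a / h" "q * y * t * w = h / q" "q * t = a / g" "1 / (t * w) = g * q / h" "1 - t = 1 - a / (g * q)"
    "q\<^sup>2 * y * t * w = h" "q * y = g" "q\<^sup>2 * t = a * q / g"
    unfolding defs using q a g h0 by (simp_all add: power2_eq_square)
  have "t * w \<noteq> 1"
    using h eqs(8) by auto
  note P.distinguished_identities(2)[OF R eqs(10)[symmetric] this]
  moreover have "q / w * (1 - q*t*w) * (1 - y*w) * pprod R 1 = a * q / h * (1 - h / g) * (1 - g * h / (a * q)) * pprod R 1"
    by (simp only: eqs(1-3))
  moreover have "q\<^sup>2 * y / (t * w) * (((1 - q\<^sup>2*t) * (1 - 1 / w) * (1 - q / w) * (1 - q*y*t*w)
    * rprod R (q*t)) / ((1 - 1 / (t * w)) * (1 - t)))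
    = g\<^sup>2 * q\<^sup>2 / h
          * (((1 - a * q / g) * (1 - a / h) * (1 - a * q / h) * (1 - h / q) * rprod R (a / g))
             / ((1 - g * q / h) * (1 - a / (g * q))))"
    by (simp only: eqs(1,4-9,12))
  moreover have "(q\<^sup>2 * y * t * w * (1 - q*y) * (1 - q*t) * (1 - q\<^sup>2*t) * rprod R (q / w)) / (1 - 1 / (t * w))
    = (h * (1 - g) * (1 - a / g) * (1 - a * q / g) * rprod R (a * q / h)) / (1 - g * q / h)"
    by (simp only: eqs(1,7,8,10-12))
  moreover have "q * (1 - q / w) * (1 - q*t) * (1 - q\<^sup>2*t) * coefC q a g (h # R)
    = q * (1 - a * q / h) * (1 - a / g) * (1 - a * q / g) * coefC q a g (h # R)"
    by (simp only: eqs(1,7,12))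
  ultimately show ?thesis
    by simp
qed

lemma contiguous_all_positions:
  fixes q a b c d e f g h :: complex and i :: nat
  assumes q: "q \<noteq> 0" "norm q < 1"
    and nonzero: "a \<noteq> 0"
      "b \<noteq> 0"
      "c \<noteq> 0"
      "d \<noteq> 0"
      "e \<noteq> 0"
      "f \<noteq> 0"
      "g \<noteq> 0"
      "h \<noteq> 0" and a: "a \<noteq> q"
    and balanced: "b * c * d * e * f * g * h = a ^ 3 * q\<^sup>2"
    and position: "i < 7"
    and nonsingular:
      "Phi_nonsingular q i a [b, c, d, e, f, g, h]"
      "Phi_nonsingular q i (a * q\<^sup>2) [b * q, c * q, d * q, e * q, f * q, g, h * q]"
      "Phi_nonsingular q i (a / q\<^sup>2) [b / q, c / q, d / q, e / q, f / q, g, h / q]"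
    and S: "S = [h, b, c, d, e, f]"
  shows "coefA q a g S * (q * (1 - a * q) * (1 - a * q\<^sup>2) * pprod S 1
              / ((1 - a * q / g) * (1 - a * q\<^sup>2 / g) * rprod S (a * q)))
           * Phi q i (a * q\<^sup>2) [b * q, c * q, d * q, e * q, f * q, g, h * q]
       + rprod S a / ((1 - a) * (1 - a / q)) * Phi q i (a / q\<^sup>2) [b / q, c / q, d / q, e / q, f / q, g, h / q]
       + coefC q a g S * Phi q i a [b, c, d, e, f, g, h] = 0"
    (is "_ * Phi q i _ ?up + _ * Phi q i _ ?down + _ * Phi q i _ ?level = 0")
\<comment> \<open>Positions count from 0, so 5 is the place of g, the one letter that the shifts
  leave fixed.\<close>
proof (cases "i = 5")
  case True
  have len: "i < length ?up" "i < length ?down" "i < length ?level"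
    using position by simp_all
  have nz: "\<forall>r\<in>set ?up. r \<noteq> 0" "\<forall>r\<in>set ?down. r \<noteq> 0" "\<forall>r\<in>set ?level. r \<noteq> 0"
    using q nonzero by simp_all
  have "mset (map (\<lambda>r. r * q) S) = mset (others ?up i)" "g = ?up ! i"
    "mset (map (\<lambda>r. r / q) S) = mset (others ?down i)" "g = ?down ! i"
    "mset S = mset (others ?level i)" "g = ?level ! i"
    by (simp_all add: S True others_def)
  note eq = Phi_eq_Phi_dist[OF len(1) nz(1) this(1,2)] Phi_eq_Phi_dist[OF len(2) nz(2) this(3,4)]
    Phi_eq_Phi_dist[OF len(3) nz(3) this(5,6)]
  show ?thesis
    unfolding eq
    by (rule contiguous_special_letter[OF q nonzero(1,7) _ a])
      (use nonzero balanced nonsingular in \<open>simp_all add: S eq[unfolded S list.map] mult_ac\<close>)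
next
  case False
  then obtain p R where p: "p \<in> {b, c, d, e, f, h}" "mset S = mset (p # R)"
    and up: "mset (g # map (\<lambda>r. r * q) R) = mset (others ?up i)" "p * q = ?up ! i"
    and down: "mset (g # map (\<lambda>r. r / q) R) = mset (others ?down i)" "p / q = ?down ! i"
    and level: "mset (g # R) = mset (others ?level i)" "p = ?level ! i"
  proof -
    consider "i = 0" | "i = 1" | "i = 2" | "i = 3" | "i = 4" | "i = 6"
      using position False by linarith
    then show thesis
    proof cases
      case 1 then show thesis by (intro that[of b "[c, d, e, f, h]"]) (simp_all add: S others_def)
    next
      case 2 then show thesis by (intro that[of c "[b, d, e, f, h]"]) (simp_all add: S others_def)
    next
      case 3 then show thesis by (intro that[of d "[b, c, e, f, h]"]) (simp_all add: S others_def)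
    next
      case 4 then show thesis by (intro that[of e "[b, c, d, f, h]"]) (simp_all add: S others_def)
    next
      case 5 then show thesis by (intro that[of f "[b, c, d, e, h]"]) (simp_all add: S others_def)
    next
      case 6 then show thesis by (intro that[of h "[b, c, d, e, f]"]) (simp_all add: S others_def)
    qed
  qed
  have len: "i < length ?up" "i < length ?down" "i < length ?level"
    using position by simp_all
  have nz: "\<forall>r\<in>set ?up. r \<noteq> 0" "\<forall>r\<in>set ?down. r \<noteq> 0" "\<forall>r\<in>set ?level. r \<noteq> 0"
    using q nonzero by simp_all
  note eq = Phi_eq_Phi_dist[OF len(1) nz(1) up] Phi_eq_Phi_dist[OF len(2) nz(2) down]
    Phi_eq_Phi_dist[OF len(3) nz(3) level]
  have "set S = set (p # R)" "length S = length (p # R)" "prod_list S = prod_list (p # R)"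
    using p(2) by (metis mset_eq_setD mset_eq_length prod_mset_prod_list)+
  moreover have "prod_list S * g = a ^ 3 * q\<^sup>2"
    using balanced by (simp add: S mult_ac)
  ultimately have R: "length R = 5" "\<forall>r\<in>set R. r \<noteq> 0" "p \<noteq> 0" "p * prod_list R * g = a ^ 3 * q\<^sup>2"
    using nonzero by (auto simp: S)
  show ?thesis
    unfolding eq coef_mset[OF p(2)] prods_mset[OF p(2)]
    by (rule contiguous_distinguished_letter[OF q nonzero(1,7) R(3,2) a R(1,4)])
      (use nonsingular in \<open>simp_all only: eq\<close>)
qed

text \<open>The products in the theorem omit h. The factor 1 - a q/(g h) of \<open>coefA\<close> is
  recovered from (a g q/h)(1 - g h/(a q)) = -g^2 (1 - a q/(g h)), whence the minus sign.\<close>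

lemma upper_coefficient:
  fixes q :: complex
  assumes "u * v = - (g\<^sup>2 * w)" and "q \<noteq> 0" "h0 \<noteq> 0" "g0 \<noteq> 0" "g1 \<noteq> 0"
  shows "u * ((n1 * n2 * Rg) / (g1 * g2 * Ra)) * v * h1 * P
    = - (q * h0 * g0 * g1) * ((g / q)\<^sup>2 * (w * Rg) / (g0 * g1) * (q * n1 * n2 * (h1 * P) / (g1 * g2 * (h0 * Ra))))"
proof -
  have "u * ((n1 * n2 * Rg) / (g1 * g2 * Ra)) * v * h1 * P = u * v * (n1 * n2 * Rg / (g1 * g2 * Ra) * h1 * P)"
    by simp
  then show ?thesis
    unfolding assms(1) using assms(2-) by (simp add: power2_eq_square mult_ac)
qed

theorem theorem2p5:
  fixes q a b c d e f g h :: complex and i :: nat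
  assumes q: "q \<noteq> 0" "norm q < 1"
    and nonzero: "a \<noteq> 0" "b \<noteq> 0" "c \<noteq> 0" "d \<noteq> 0" "e \<noteq> 0" "f \<noteq> 0" "g \<noteq> 0" "h \<noteq> 0"
    and balanced: "b * c * d * e * f * g * h = a ^ 3 * q\<^sup>2"
    and position: "i < 7"
    and nonsingular:
      "Phi_nonsingular q i a [b, c, d, e, f, g, h]"
      "Phi_nonsingular q i (a * q\<^sup>2) [b * q, c * q, d * q, e * q, f * q, g, h * q]"
      "Phi_nonsingular q i (a / q\<^sup>2) [b / q, c / q, d / q, e / q, f / q, g, h / q]"
    and coefficients:
      "1 - a * q / g \<noteq> 0" "1 - a * q\<^sup>2 / g \<noteq> 0" "\<forall>p\<in>set [b, c, d, e, f]. 1 - a * q / p \<noteq> 0"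
      "1 - a / q \<noteq> 0" "1 - a \<noteq> 0" "1 - g * q / h \<noteq> 0" "1 - a / (g * q) \<noteq> 0"
  shows
    "a * g * q / h
       * (((1 - a * q) * (1 - a * q\<^sup>2) * (\<Prod>p\<leftarrow>[b, c, d, e, f]. 1 - a * q / (g * p)))
          / ((1 - a * q / g) * (1 - a * q\<^sup>2 / g) * (\<Prod>p\<leftarrow>[b, c, d, e, f]. 1 - a * q / p)))
       * (1 - g * h / (a * q)) * (1 - h) * (\<Prod>p\<leftarrow>[b, c, d, e, f]. 1 - p)
       * Phi q i (a * q\<^sup>2) [b * q, c * q, d * q, e * q, f * q, g, h * q]
     - (q * (1 - a / g) * (1 - a * q / g) * (1 - a / h) * (1 - a * q / h)
          * (\<Prod>p\<leftarrow>[b, c, d, e, f]. 1 - a / p))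
         / ((1 - a / q) * (1 - a))
       * Phi q i (a / q\<^sup>2) [b / q, c / q, d / q, e / q, f / q, g, h / q]
     - (a * q / h * (1 - h / g) * (1 - g * h / (a * q)) * (\<Prod>p\<leftarrow>[b, c, d, e, f]. 1 - p)
        + g\<^sup>2 * q\<^sup>2 / h
          * (((1 - a * q / g) * (1 - a / h) * (1 - a * q / h) * (1 - h / q)
                * (\<Prod>p\<leftarrow>[b, c, d, e, f]. 1 - a / (g * p)))
             / ((1 - g * q / h) * (1 - a / (g * q))))
        - (h * (1 - g) * (1 - a / g) * (1 - a * q / g) * (\<Prod>p\<leftarrow>[b, c, d, e, f]. 1 - a * q / (h * p)))
          / (1 - g * q / h))
       * Phi q i a [b, c, d, e, f, g, h]
     = 0"
proof -
  define R where "R = [b, c, d, e, f]"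
  \<comment> \<open>h comes first, so that S splits as \<open>h # R\<close>, the form in which the
    bracket is treated.\<close>
  define S where "S = [h, b, c, d, e, f]"
  have SR: "S = h # R"
    by (simp add: S_def R_def)
  have aq: "a \<noteq> q"
    using coefficients(4) q by auto
  let ?up = "Phi q i (a * q\<^sup>2) [b * q, c * q, d * q, e * q, f * q, g, h * q]"
  let ?down = "Phi q i (a / q\<^sup>2) [b / q, c / q, d / q, e / q, f / q, g, h / q]"
  let ?level = "Phi q i a [b, c, d, e, f, g, h]"
  define k where "k = q * (1 - a * q) * (1 - a * q\<^sup>2) * pprod S 1
              / ((1 - a * q / g) * (1 - a * q\<^sup>2 / g) * rprod S (a * q))"
  \<comment> \<open>The claim is -l times \<open>relation\<close>; comparing the terms of the
    downward series yields this l.\<close>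
  define l where "l = q * (1 - a * q / h) * (1 - a / g) * (1 - a * q / g)"
  have relation: "coefA q a g S * k * ?up + rprod S a / ((1 - a) * (1 - a / q)) * ?down + coefC q a g S * ?level = 0"
    unfolding k_def
    by (rule contiguous_all_positions[OF q nonzero aq balanced position nonsingular S_def])
  have prods: "(\<Prod>p\<leftarrow>[b, c, d, e, f]. 1 - a * q / (g * p)) = rprod R (a * q / g)"
    "(\<Prod>p\<leftarrow>[b, c, d, e, f]. 1 - a * q / p) = rprod R (a * q)"
    "(\<Prod>p\<leftarrow>[b, c, d, e, f]. 1 - p) = pprod R 1"
    "(\<Prod>p\<leftarrow>[b, c, d, e, f]. 1 - a / p) = rprod R a"
    "(\<Prod>p\<leftarrow>[b, c, d, e, f]. 1 - a / (g * p)) = rprod R (a / g)"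
    "(\<Prod>p\<leftarrow>[b, c, d, e, f]. 1 - a * q / (h * p)) = rprod R (a * q / h)"
    by (simp_all add: R_def)
  have ah: "1 - a * q / h \<noteq> 0" and ag: "1 - a / g \<noteq> 0"
  proof -
    have "W10_9_nonsingular q a [b, c, d, e, f, g, h]"
      "W10_9_nonsingular q (a / q\<^sup>2) [b / q, c / q, d / q, e / q, f / q, g, h / q]"
      using nonsingular(1,3) unfolding Phi_nonsingular_def Let_def by blast+
    \<comment> \<open>1 - a/g is the second factor of the symbol of a/(g q) in the downward series,
      hence the index 2.\<close>
    from W10_9_nonsingularD(3)[OF this(1), of 1] W10_9_nonsingularD(3)[OF this(2), of 2]
    show "1 - a * q / h \<noteq> 0" "1 - a / g \<noteq> 0"
      using q by (simp_all add: numeral_2_eq_2 qpoch_Suc power2_eq_square)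
  qed
  have up: "a * g * q / h
       * (((1 - a * q) * (1 - a * q\<^sup>2) * rprod R (a * q / g))
          / ((1 - a * q / g) * (1 - a * q\<^sup>2 / g) * rprod R (a * q)))
       * (1 - g * h / (a * q)) * (1 - h) * pprod R 1 = - l * (coefA q a g S * k)"
  proof -
    have "a * g * q / h * (1 - g * h / (a * q)) = - (g\<^sup>2 * (1 - a * q / g / h))"
      using q nonzero by (simp add: field_simps power2_eq_square)
    from upper_coefficient[OF this q(1) ah ag coefficients(1)] show ?thesis
      by (simp only: l_def coefA_def k_def SR pprod_simps rprod_simps mult_1_right)
  qed
  have down: "(q * (1 - a / g) * (1 - a * q / g) * (1 - a / h) * (1 - a * q / h) * rprod R a) / ((1 - a / q) * (1 - a))
    = l * (rprod S a / ((1 - a) * (1 - a / q)))"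
    by (simp add: l_def SR mult_ac)
  have level: "a * q / h * (1 - h / g) * (1 - g * h / (a * q)) * pprod R 1
        + g\<^sup>2 * q\<^sup>2 / h
          * (((1 - a * q / g) * (1 - a / h) * (1 - a * q / h) * (1 - h / q) * rprod R (a / g))
             / ((1 - g * q / h) * (1 - a / (g * q))))
        - (h * (1 - g) * (1 - a / g) * (1 - a * q / g) * rprod R (a * q / h)) / (1 - g * q / h)
     = l * coefC q a g S"
    unfolding l_def SR
    by (rule coefC_statement) (use q nonzero aq ag coefficients balanced in \<open>auto simp: R_def mult_ac\<close>)
  have "- l * (coefA q a g S * k) * ?up - l * (rprod S a / ((1 - a) * (1 - a / q))) * ?down - l * coefC q a g S * ?level
    = - l * (coefA q a g S * k * ?up + rprod S a / ((1 - a) * (1 - a / q)) * ?down + coefC q a g S * ?level)"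
    by (simp add: algebra_simps)
  then show ?thesis
    unfolding prods up down level relation by simp
qed

end
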